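(* Let $q$ be a prime power, $k\geq 2$, and $n=p_z^{e_z}\cdots p_1^{e_1}k$, where $p_1>\cdots>p_z$ are distinct odd primes and $e_1,\dots,e_z\geq 1$; set $\ell_j=\frac{p_j-3}{2}$ for $j=1,\dots,z$. Let ${_{p_z^{e_z}\cdots p_1^{e_1}}}\mathcal{C}_k\subseteq\mathcal{G}_q(n,k)$ be the code constructed as follows. (Building block.) For an odd prime $p$ and an integer $m\geq 2$, let $\ell=\frac{p-3}{2}$, let $\omega$ be a primitive element of $\mathbb{F}_{q^m}$ and $\gamma\in\mathbb{F}_{q^{pm}}$ with $\mathbb{F}_{q^m}(\gamma)=\mathbb{F}_{q^{pm}}$. For $0\leq\ell_0\leq\ell$ and $\underline{\alpha}=(\alpha_1,\dots,\alpha_{\ell_0})$ with $\alpha_1,\dots,\alpha_{\ell_0-1}\in\mathbb{F}_{q^m}$, $\alpha_{\ell_0}\in\mathbb{F}_{q^m}^*$ (empty tuple if $\ell_0=0$), put $P_{\underline{\alpha}}(\gamma)=1+\alpha_1\gamma+\cdots+\alpha_{\ell_0}\gamma^{\ell_0}$. For every index $\underline{h}=(\underline{\alpha},a,j,\ell_1)$ with $a\in\mathbb{F}_{q^m}$, $0\leq j\leq q-2$, $\ell_0\leq \ell_1\leq\ell$, consider the injective $\mathbb{F}_q$-linear map $\Phi_{\underline h}:\mathbb{F}_{q^m}\to\mathbb{F}_{q^{pm}}$, $u\mapsto uP_{\underline{\alpha}}(\gamma)+\omega^j(u^q+au)\gamma^{\ell_1+1}$, and $V_{\underline h}=\mathrm{Im}(\Phi_{\underline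 h})$. Let ${_p}\mathcal{C}_m\subseteq\mathcal{G}_q(pm,m)$ be the union over all $\ell_0\in\{0,\dots,\ell\}$ and all such $\underline h$ of the orbits $\mathrm{Orb}(V_{\underline h})=\{\beta V_{\underline h}:\beta\in\mathbb{F}_{q^{pm}}^*\}$. (Nesting operation $\odot$.) If $\mathcal{C}_1\subseteq\mathcal{G}_q(m,k')$ is a cyclic subspace code with codewords $U_1,\dots,U_t$, and $\mathcal{C}_2=\bigcup_{h}\mathrm{Orb}(V_{2,h})\subseteq\mathcal{G}_q(rm,m)$ where each $V_{2,h}=\mathrm{Im}(\Phi_{2,h})$ for an injective $\mathbb{F}_q$-linear map $\Phi_{2,h}:\mathbb{F}_{q^m}\to\mathbb{F}_{q^{rm}}$, define $\mathcal{C}_2\odot\mathcal{C}_1=\bigcup_h\bigcup_{i=1}^t\mathrm{Orb}(\Phi_{2,h}(U_i))\subseteq\mathcal{G}_q(rm,k')$, and iteratively $\mathcal{C}_e\odot\cdots\odot\mathcal{C}_1=\mathcal{C}_e\odot(\mathcal{C}_{e-1}\odot\cdots\odot\mathcal{C}_1)$. (For codes obtained this way, the orbit representatives are again images of injective $\mathbb{F}_q$-linear maps, namely compositions of the maps $\Phi$ above, each pre-multiplied by a nonzero field element, so the operation can be iterated.) (The code.) For $j=1,\dots,z$ let $N_j=\prod_{h=1}^{j-1}p_h^{e_h}k$ (so $N_1=k$) and ${_{p_j^{e_j}}}\mathcal{C}_{N_j}=\bigodot_{i=1}^{e_j}{_{p_j}}\mathcal{C}_{p_j^{i-1}N_j}\subseteq\mathcal{G}_q(p_j^{e_j}N_j,N_j)$;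 then ${_{p_z^{e_z}\cdots p_1^{e_1}}}\mathcal{C}_k={_{p_z^{e_z}}}\mathcal{C}_{N_z}\odot\cdots\odot{_{p_2^{e_2}}}\mathcal{C}_{N_2}\odot{_{p_1^{e_1}}}\mathcal{C}_{N_1}$. Then ${_{p_z^{e_z}\cdots p_1^{e_1}}}\mathcal{C}_k$ is a multi-orbit cyclic subspace code in $\mathcal{G}_q(n,k)$ of cardinality \[ \left\lvert{_{p_z^{e_z}\cdots p_1^{e_1}}}\mathcal{C}_k\right\rvert=\prod_{j=1}^{z}\prod_{i_j=1}^{e_j}\left(\frac{q^{p_j^{i_j-1}\prod_{h=1}^{j-1}p_h^{e_h}k}\left(q^{(\ell_j+1)p_j^{i_j-1}\prod_{h=1}^{j-1}p_h^{e_h}k}-1\right)\left(q^{p_j^{i_j}\prod_{h=1}^{j-1}p_h^{e_h}k}-1\right)}{q^{p_j^{i_j-1}\prod_{h=1}^{j-1}p_h^{e_h}k}-1}\right) \] and minimum distance $2k-2$.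
   Context: Subspace distance $d(U,V)=\dim(U+V)-\dim(U\cap V)$ on $\mathbb{F}_q$-subspaces of $\mathbb{F}_{q^n}$; $\mathcal{G}_q(n,k)$ is the set of $k$-dimensional $\mathbb{F}_q$-subspaces of $\mathbb{F}_{q^n}$; a cyclic subspace code is a union of orbits $\mathrm{Orb}(V)=\{\alpha V:\alpha\in\mathbb{F}_{q^n}^*\}$. Empty products equal $1$. *)

theory Defs
  imports Complex_Main "HOL-Computational_Algebra.Primes"
begin

text \<open>Ambient field: a finite field 'a of order q^n (playing F_{q^n}).
  For m dividing n, the subfield F_{q^m} is the set of roots of X^(q^m) - X.\<close>

definition sub :: "nat \<Rightarrow> nat \<Rightarrow> 'a::{field,finite} set" where
  "sub q m = {x. x ^ (q ^ m) = x}"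

definition fq_subspace :: "nat \<Rightarrow> 'a::{field,finite} set \<Rightarrow> bool" where
  "fq_subspace q V \<longleftrightarrow> 0 \<in> V \<and> (\<forall>u\<in>V. \<forall>v\<in>V. u + v \<in> V)
      \<and> (\<forall>c\<in>sub q 1. \<forall>v\<in>V. c * v \<in> V)"

definition sdim :: "nat \<Rightarrow> 'a::{field,finite} set \<Rightarrow> nat" where
  "sdim q V = (THE d. card V = q ^ d)"

definition grass :: "nat \<Rightarrow> nat \<Rightarrow> nat \<Rightarrow> 'a::{field,finite} set set" where
  "grass q m d = {V. V \<subseteq> sub q m \<and> fq_subspace q V \<and> sdim q V = d}"

definition ssum :: "'a::{field,finite} set \<Rightarrow> 'a set \<Rightarrow> 'a set" where
  "ssum U V = {u + v | u v. u \<in> U \<and> v \<in> V}"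

definition subspace_dist :: "nat \<Rightarrow> 'a::{field,finite} set \<Rightarrow> 'a set \<Rightarrow> nat" where
  "subspace_dist q U V = sdim q (ssum U V) - sdim q (U \<inter> V)"

definition min_dist :: "nat \<Rightarrow> 'a::{field,finite} set set \<Rightarrow> nat" where
  "min_dist q C = Min {subspace_dist q U V | U V. U \<in> C \<and> V \<in> C \<and> U \<noteq> V}"

definition orb :: "nat \<Rightarrow> nat \<Rightarrow> 'a::{field,finite} set \<Rightarrow> 'a set set" where
  "orb q M V = {(\<lambda>x. \<beta> * x) ` V | \<beta>. \<beta> \<in> sub q M - {0}}"

definition primitive_elem :: "nat \<Rightarrow> nat \<Rightarrow> 'a::{field,finite} \<Rightarrow> bool" where
  "primitive_elem q m w \<longleftrightarrow> w \<in> sub q m - {0} \<and> (\<forall>x\<in>sub q m - {0}. \<exists>i::nat. x = w ^ i)"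

definition is_subfield :: "'a::{field,finite} set \<Rightarrow> bool" where
  "is_subfield K \<longleftrightarrow> 0 \<in> K \<and> 1 \<in> K \<and> (\<forall>x\<in>K. \<forall>y\<in>K. x + y \<in> K \<and> x * y \<in> K)
      \<and> (\<forall>x\<in>K. - x \<in> K \<and> inverse x \<in> K)"

definition generates :: "nat \<Rightarrow> nat \<Rightarrow> nat \<Rightarrow> 'a::{field,finite} \<Rightarrow> bool" where
  "generates q m M g \<longleftrightarrow> g \<in> sub q M \<and>
     (\<forall>K. is_subfield K \<and> sub q m \<subseteq> K \<and> g \<in> K \<longrightarrow> sub q M \<subseteq> K)"

definition block_fam :: "nat \<Rightarrow> nat \<Rightarrow> nat \<Rightarrow> 'a::{field,finite} \<Rightarrow> 'a \<Rightarrow> ('a \<Rightarrow> 'a) set" where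
  "block_fam q p m w g =
    {(\<lambda>u. u * (1 + (\<Sum>i=1..l0. \<alpha> i * g ^ i)) + w ^ jj * (u ^ q + a * u) * g ^ (l1 + 1))
      | l0 \<alpha> a jj l1. l0 \<le> (p - 3) div 2
          \<and> (\<forall>i\<in>{1..<l0}. \<alpha> i \<in> sub q m) \<and> (0 < l0 \<longrightarrow> \<alpha> l0 \<in> sub q m - {0})
          \<and> a \<in> sub q m \<and> jj \<le> q - 2 \<and> l0 \<le> l1 \<and> l1 \<le> (p - 3) div 2}"

definition block_code :: "nat \<Rightarrow> nat \<Rightarrow> nat \<Rightarrow> 'a::{field,finite} \<Rightarrow> 'a \<Rightarrow> 'a set set" where
  "block_code q p m w g = \<Union>{orb q (p * m) (\<Phi> ` sub q m) | \<Phi>. \<Phi> \<in> block_fam q p m w g}"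

text \<open>Nesting: C2 odot C1, with C2 given by its family of maps into F_{q^M}.\<close>
definition odot :: "nat \<Rightarrow> nat \<Rightarrow> ('a::{field,finite} \<Rightarrow> 'a) set \<Rightarrow> 'a set set \<Rightarrow> 'a set set" where
  "odot q M F C = \<Union>{orb q M (\<Phi> ` U) | \<Phi> U. \<Phi> \<in> F \<and> U \<in> C}"

definition comp_fam :: "nat \<Rightarrow> nat \<Rightarrow> ('a::{field,finite} \<Rightarrow> 'a) set \<Rightarrow> ('a \<Rightarrow> 'a) set \<Rightarrow> ('a \<Rightarrow> 'a) set" where
  "comp_fam q m F2 F1 = {(\<lambda>u. \<Phi>2 (\<beta> * \<Phi>1 u)) | \<Phi>2 \<Phi>1 \<beta>. \<Phi>2 \<in> F2 \<and> \<Phi>1 \<in> F1 \<and> \<beta> \<in> sub q m - {0}}"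

text \<open>_{p^e}C_N = _pC_{p^{e-1}N} odot ... odot _pC_N (codewords), and its maps.
  Choices omega, gamma are indexed by the level m of the building block.\<close>
fun pe_code :: "nat \<Rightarrow> nat \<Rightarrow> nat \<Rightarrow> (nat \<Rightarrow> 'a::{field,finite}) \<Rightarrow> (nat \<Rightarrow> 'a) \<Rightarrow> nat \<Rightarrow> 'a set set" where
  "pe_code q p N w g 0 = {}"
| "pe_code q p N w g (Suc 0) = block_code q p N (w N) (g N)"
| "pe_code q p N w g (Suc (Suc i)) =
     odot q (p ^ (Suc (Suc i)) * N) (block_fam q p (p ^ Suc i * N) (w (p ^ Suc i * N)) (g (p ^ Suc i * N)))
       (pe_code q p N w g (Suc i))"

fun pe_fam :: "nat \<Rightarrow> nat \<Rightarrow> nat \<Rightarrow> (nat \<Rightarrow> 'a::{field,finite}) \<Rightarrow> (nat \<Rightarrow> 'a) \<Rightarrow> nat \<Rightarrow> ('a \<Rightarrow> 'a) set" where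
  "pe_fam q p N w g 0 = {}"
| "pe_fam q p N w g (Suc 0) = block_fam q p N (w N) (g N)"
| "pe_fam q p N w g (Suc (Suc i)) =
     comp_fam q (p ^ Suc i * N) (block_fam q p (p ^ Suc i * N) (w (p ^ Suc i * N)) (g (p ^ Suc i * N)))
       (pe_fam q p N w g (Suc i))"

definition Nlev :: "(nat \<Rightarrow> nat) \<Rightarrow> (nat \<Rightarrow> nat) \<Rightarrow> nat \<Rightarrow> nat \<Rightarrow> nat" where
  "Nlev p e k j = (\<Prod>h\<in>{1..<j}. p h ^ e h) * k"

fun full_code :: "nat \<Rightarrow> (nat \<Rightarrow> nat) \<Rightarrow> (nat \<Rightarrow> nat) \<Rightarrow> nat \<Rightarrow> (nat \<Rightarrow> 'a::{field,finite}) \<Rightarrow> (nat \<Rightarrow> 'a) \<Rightarrow> nat \<Rightarrow> 'a set set" where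
  "full_code q p e k w g 0 = {}"
| "full_code q p e k w g (Suc 0) = pe_code q (p 1) (Nlev p e k 1) w g (e 1)"
| "full_code q p e k w g (Suc (Suc j)) =
     odot q (Nlev p e k (Suc (Suc (Suc j))))
       (pe_fam q (p (Suc (Suc j))) (Nlev p e k (Suc (Suc j))) w g (e (Suc (Suc j))))
       (full_code q p e k w g (Suc j))"

end

theory Submission
  imports Defs "HOL-Computational_Algebra.Polynomial"
begin

text \<open>A composed map is applied one factor at a time, so the whole code arises from the single
  codeword \<open>F_{q^k}\<close> by iterating \<open>C \<mapsto> odot (block_fam) C\<close>. The invariant is that distinct codewords
  meet in dimension at most one. It is preserved, and the cardinality is multiplied by the claimed
  factor, because of a separation property: if \<open>\<beta> \<Phi>_h(u_i) = \<Phi>_h'(v_i)\<close> for \<open>i = 1, 2\<close> and \<open>u_1\<close>, \<open>u_2\<close>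
  are independent over \<open>F_q\<close>, then \<open>h = h'\<close> and \<open>\<beta> \<in> F_q\<close>. Indeed
  \<open>\<Phi>_h(u_1) \<Phi>_h'(v_2) = \<Phi>_h(u_2) \<Phi>_h'(v_1)\<close> compares polynomials in \<open>\<gamma>\<close> of degree at most \<open>p - 1\<close>,
  hence holds coefficientwise: the constant term gives \<open>u_1 / u_2 = v_1 / v_2\<close>, and the remaining
  coefficients recover the index. Distance \<open>2 k - 2\<close> is attained by \<open>V\<close> and \<open>(x / y) V\<close> with
  independent \<open>x, y \<in> V\<close>.\<close>

subsection \<open>Subfields of a finite field\<close>

text \<open>Multiplication by a nonzero \<open>x\<close> permutes the nonzero elements, so their
  product absorbs the factor \<open>x ^ card ?U\<close>.\<close>

lemma finite_field_power_card:
  fixes x :: "'a::{field,finite}"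
  shows "x ^ card (UNIV :: 'a set) = x"
proof (cases "x = 0")
  case False
  let ?U = "UNIV - {0::'a}"
  have bij: "bij_betw ((*) x) ?U ?U"
    using False by (intro bij_betw_byWitness[of _ "\<lambda>y. y / x"]) auto
  have "\<Prod>?U = (\<Prod>y\<in>?U. x * y)"
    by (rule prod.reindex_bij_betw[OF bij, symmetric])
  also have "\<dots> = x ^ card ?U * \<Prod>?U"
    by (simp add: prod.distrib)
  finally have "x ^ card ?U = 1"
    by simp
  moreover have "card (UNIV :: 'a set) = Suc (card ?U)"
    using finite_UNIV_card_ge_0[where ?'a = 'a] by simp
  ultimately show ?thesis
    by (simp only: power_Suc mult_1_right)
qed (use finite_UNIV_card_ge_0[where ?'a = 'a] in simp)

text \<open>Translation by 1 permutes the field, so adding 1 to every summand leaves the sum of all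
  elements unchanged.\<close>

lemma of_nat_card_UNIV_eq_0:
  "of_nat (card (UNIV :: 'a set)) = (0 :: 'a::{field,finite})"
proof -
  have bij: "bij_betw (\<lambda>x::'a. x + 1) UNIV UNIV"
    by (intro bij_betw_byWitness[of _ "\<lambda>x. x - 1"]) auto
  have "(\<Sum>x\<in>UNIV. x + 1) = \<Sum>(UNIV :: 'a set)"
    by (rule sum.reindex_bij_betw[OF bij])
  then show ?thesis
    by (simp add: sum.distrib)
qed

text \<open>Serves two counts with fibres of constant size: the parametrisation of codewords and the
  addition map onto a sum of subspaces.\<close>

lemma card_eq_fibres:
  assumes "finite A" "\<And>y. y \<in> f ` A \<Longrightarrow> card {x \<in> A. f x = y} = c"
  shows "card A = c * card (f ` A)"
proof -
  have "card A = (\<Sum>y\<in>f ` A. card {x \<in> A. f x = y})"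
    unfolding card_eq_sum by (rule sum.image_gen[OF assms(1)])
  also have "\<dots> = c * card (f ` A)"
    using assms(2) by simp
  finally show ?thesis .
qed

text \<open>Kept at ring level because it is applied both to integers and to polynomials.\<close>

lemma power_diff_dvd:
  fixes x :: "'a::comm_ring_1"
  assumes "d dvd e"
  shows "x ^ d - 1 dvd x ^ e - 1"
proof -
  obtain c where c: "e = d * c"
    using assms by blast
  show ?thesis
    unfolding c power_mult by (metis dvd_triv_left power_diff_1_eq)
qed

lemma power_diff_dvd_nat:
  fixes x :: nat
  assumes "d dvd e"
  shows "x ^ d - 1 dvd x ^ e - 1"
proof (cases "x = 0")
  case False
  have "int x ^ d - 1 dvd int x ^ e - 1"
    by (rule power_diff_dvd[OF assms])
  then have "int (x ^ d - 1) dvd int (x ^ e - 1)"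
    using False by (simp add: of_nat_diff)
  then show ?thesis
    by simp
qed (use assms in \<open>cases d; cases e; auto\<close>)

text \<open>The argument \<open>ty\<close> ties the field type \<open>'a\<close> to the locale
  parameters, which otherwise are only the numbers \<open>q\<close> and \<open>n\<close>.\<close>

locale field_of_order =
  fixes q n :: nat and ty :: "'a::{field,finite} itself"
  assumes q_prime_power: "\<exists>r s. prime r \<and> 0 < s \<and> q = r ^ s"
    and card_UNIV: "card (UNIV :: 'a set) = q ^ n"
    and n_pos: "0 < n"
begin

lemma q_ge2: "2 \<le> q"
  using q_prime_power
  by (metis One_nat_def Suc_leI not_less_iff_gr_or_eq one_less_power prime_gt_1_nat
      numeral_2_eq_2)

lemma power_gt1: "0 < d \<Longrightarrow> 1 < q ^ d"
  using q_ge2 by (intro one_less_power) auto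

lemma power_q_n [simp]: "(x::'a) ^ (q ^ n) = x"
  using finite_field_power_card[of x] card_UNIV by simp

lemma frobenius_add: "((x::'a) + y) ^ (q ^ m) = x ^ (q ^ m) + y ^ (q ^ m)"
proof -
  obtain r s where rs: "prime r" "0 < s" "q = r ^ s"
    using q_prime_power by blast
  \<comment> \<open>The prime characteristic divides \<open>q ^ n\<close>, hence is the prime below
    \<open>q\<close>; so \<open>q ^ m\<close> is a power of it.\<close>
  have "CHAR('a) dvd q ^ n"
    using of_nat_card_UNIV_eq_0[where ?'a = 'a]
    unfolding card_UNIV of_nat_eq_0_iff_char_dvd .
  moreover have pr: "prime CHAR('a)"
    using prime_CHAR_semidom[where ?'a = 'a] finite_imp_CHAR_pos[where ?'a = 'a] by auto
  ultimately have "CHAR('a) = r"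
    using rs by (metis prime_dvd_power primes_dvd_imp_eq)
  then have "q ^ m = CHAR('a) ^ (s * m)"
    using rs by (simp add: power_mult)
  then show ?thesis
    using freshmans_dream'[OF pr] by blast
qed

lemma sub_0 [simp]: "(0::'a) \<in> sub q m"
  using q_ge2 by (simp add: sub_def)

lemma sub_1 [simp]: "(1::'a) \<in> sub q m"
  by (simp add: sub_def)

lemma sub_add: "(x::'a) \<in> sub q m \<Longrightarrow> y \<in> sub q m \<Longrightarrow> x + y \<in> sub q m"
  by (simp add: sub_def frobenius_add)

lemma sub_mult: "(x::'a) \<in> sub q m \<Longrightarrow> y \<in> sub q m \<Longrightarrow> x * y \<in> sub q m"
  by (simp add: sub_def power_mult_distrib)

lemma sub_inverse: "(x::'a) \<in> sub q m \<Longrightarrow> inverse x \<in> sub q m"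
  by (simp add: sub_def power_inverse)

lemma sub_divide: "(x::'a) \<in> sub q m \<Longrightarrow> y \<in> sub q m \<Longrightarrow> x / y \<in> sub q m"
  by (simp add: sub_def power_divide)

lemma sub_power: "(x::'a) \<in> sub q m \<Longrightarrow> x ^ i \<in> sub q m"
  by (induction i) (auto intro: sub_mult)

lemma sub_uminus: "(x::'a) \<in> sub q m \<Longrightarrow> - x \<in> sub q m"
proof -
  assume x: "x \<in> sub q m"
  have "x ^ (q ^ m) + (- x) ^ (q ^ m) = 0"
    using frobenius_add[of x "- x" m] q_ge2 by (simp add: power_0_left)
  with x show ?thesis
    by (simp add: sub_def add_eq_0_iff)
qed

lemma sub_diff: "(x::'a) \<in> sub q m \<Longrightarrow> y \<in> sub q m \<Longrightarrow> x - y \<in> sub q m"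
  using sub_add[of x m "- y"] sub_uminus[of y m] by simp

lemma sub_mono:
  assumes "m dvd M"
  shows "(sub q m :: 'a set) \<subseteq> sub q M"
proof
  fix x :: 'a
  assume x: "x \<in> sub q m"
  obtain c where c: "M = m * c"
    using assms by blast
  have "x ^ ((q ^ m) ^ c) = x"
    by (induction c) (use x in \<open>auto simp: sub_def power_mult\<close>)
  then show "x \<in> sub q M"
    by (simp add: sub_def c power_mult)
qed

text \<open>If \<open>d\<close> divides \<open>N = q ^ n - 1\<close>, the cofactor of \<open>X ^ d - 1\<close> in \<open>X ^ N - 1\<close> has at most
  \<open>N - d\<close> of the \<open>N\<close> nonzero field elements as roots; the others are roots of \<open>X ^ d - 1\<close>.\<close>

lemma card_sub:
  assumes "m dvd n" "0 < m"
  shows "card (sub q m :: 'a set) = q ^ m"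
proof -
  define d N where "d = q ^ m - 1" and "N = q ^ n - 1"
  have d: "0 < d"
    using power_gt1[OF assms(2)] by (simp add: d_def)
  have N: "0 < N"
    using power_gt1[OF n_pos] by (simp add: N_def)
  have Nd: "Suc N = q ^ n" "Suc d = q ^ m"
    using power_gt1[OF n_pos] power_gt1[OF assms(2)] unfolding N_def d_def by linarith+
  have "d dvd N"
    unfolding d_def N_def by (rule power_diff_dvd_nat[OF assms(1)])
  define A B :: "'a poly" where "A = monom 1 d - 1" and "B = monom 1 N - 1"
  have "A dvd B"
    using power_diff_dvd[OF \<open>d dvd N\<close>, of "monom (1::'a) 1"]
    by (simp add: A_def B_def monom_power)
  then obtain G where G: "B = A * G"
    by blast
  have deg: "degree (monom (1::'a) e - 1) = e" if "0 < e" for e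
    using degree_add_eq_left[of "- 1" "monom (1::'a) e"] that by (simp add: degree_monom_eq)
  have "B \<noteq> 0"
    using deg[OF N] N by (metis B_def degree_0 less_irrefl)
  with G have nz: "A \<noteq> 0" "G \<noteq> 0"
    by auto
  have degG: "degree G = N - d"
    using deg[OF N, folded B_def] deg[OF d, folded A_def] degree_mult_eq[OF nz] by (simp add: G)
  have root: "poly A x = 0 \<or> poly G x = 0" if "x \<noteq> 0" for x :: 'a
  proof -
    have "x * x ^ N = x ^ (q ^ n)"
      by (simp only: Nd flip: power_Suc)
    then have "poly B x = 0"
      using that by (simp add: B_def poly_monom)
    then show ?thesis
      by (simp add: G)
  qed
  have sub: "sub q m - {0} = {x::'a. poly A x = 0}"
  proof -
    have "x ^ (q ^ m) = x \<longleftrightarrow> x ^ d = 1" if "x \<noteq> 0" for x :: 'a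
    proof -
      have "x ^ (q ^ m) = x * x ^ d"
        by (simp only: Nd flip: power_Suc)
      then show ?thesis
        using that by simp
    qed
    then show ?thesis
      using d by (auto simp: sub_def A_def poly_monom power_0_left split: if_splits)
        (metis power_0_left zero_neq_one less_irrefl)+
  qed
  have "N = card (UNIV - {0::'a})"
    by (simp add: card_UNIV N_def)
  also have "\<dots> \<le> card ((sub q m - {0}) \<union> {x::'a. poly G x = 0})"
    using root by (intro card_mono) (auto simp: sub)
  also have "\<dots> \<le> card (sub q m - {0::'a}) + card {x::'a. poly G x = 0}"
    by (rule card_Un_le)
  also have "card {x::'a. poly G x = 0} \<le> N - d"
    using card_poly_roots_bound[OF nz(2)] degG by simp
  finally have "d \<le> card (sub q m - {0::'a})"
    using dvd_imp_le[OF \<open>d dvd N\<close> N] by linarith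
  moreover have "card (sub q m - {0::'a}) \<le> d"
    using card_poly_roots_bound[OF nz(1)] deg[OF d] by (simp add: sub A_def)
  ultimately have "card (sub q m - {0::'a}) = d"
    by simp
  moreover have "card (sub q m :: 'a set) = Suc (card (sub q m - {0::'a}))"
    by (intro card.remove) auto
  ultimately show ?thesis
    using Nd by (simp only:)
qed

lemma sub1_eq: "(x::'a) \<in> sub q 1 \<longleftrightarrow> x ^ q = x"
  by (simp add: sub_def)

end

subsection \<open>Linear independence of powers of a generator\<close>

text \<open>Bounding coefficients instead of \<open>degree\<close> lets the zero polynomial fit
  every bound, so for \<open>K\<close> containing 0 the count is \<open>card K ^ d\<close>, also for
  \<open>d = 0\<close>.\<close>

definition polys_below :: "'a::zero set \<Rightarrow> nat \<Rightarrow> 'a poly set" where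
  "polys_below K d = {f. (\<forall>i. coeff f i \<in> K) \<and> (\<forall>i\<ge>d. coeff f i = 0)}"

lemma polys_below_coeff: "f \<in> polys_below K d \<Longrightarrow> coeff f i \<in> K"
  by (simp add: polys_below_def)

lemma polys_below_coeff_0: "f \<in> polys_below K d \<Longrightarrow> d \<le> i \<Longrightarrow> coeff f i = 0"
  by (simp add: polys_below_def)

lemma polys_below_degree_pCons: "f \<in> polys_below K d \<Longrightarrow> degree (pCons c f) \<le> d"
  by (intro degree_le) (auto simp: polys_below_def coeff_pCons split: nat.splits)

lemma polys_below_mono: "d \<le> d' \<Longrightarrow> polys_below K d \<subseteq> polys_below K d'"
  by (auto simp: polys_below_def)

lemma pCons_in_polys_below_iff:
  "pCons c f \<in> polys_below K (Suc d) \<longleftrightarrow> c \<in> K \<and> f \<in> polys_below K d"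
proof -
  have "(\<forall>i. coeff (pCons c f) i \<in> K) \<longleftrightarrow> c \<in> K \<and> (\<forall>i. coeff f i \<in> K)"
    by (metis coeff_pCons_0 coeff_pCons_Suc not0_implies_Suc)
  moreover have "(\<forall>i\<ge>Suc d. coeff (pCons c f) i = 0) \<longleftrightarrow> (\<forall>i\<ge>d. coeff f i = 0)"
    by (metis Suc_le_D Suc_le_mono coeff_pCons_Suc)
  ultimately show ?thesis
    by (auto simp: polys_below_def)
qed

lemma card_polys_below:
  assumes "0 \<in> K" "finite K"
  shows "finite (polys_below K d) \<and> card (polys_below K d) = card K ^ d"
proof (induction d)
  case 0
  have "polys_below K 0 = {0}"
    using assms by (auto simp: polys_below_def poly_eq_iff)
  then show ?case
    by simp
next
  case (Suc d)
  let ?h = "\<lambda>(c, f). pCons c f"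
  have "polys_below K (Suc d) = ?h ` (K \<times> polys_below K d)"
  proof (intro equalityI subsetI)
    fix f
    assume f: "f \<in> polys_below K (Suc d)"
    obtain c f' where "f = pCons c f'"
      by (cases f) auto
    with f show "f \<in> ?h ` (K \<times> polys_below K d)"
      by (auto simp: pCons_in_polys_below_iff intro!: image_eqI[of _ _ "(c, f')"])
  qed (auto simp: pCons_in_polys_below_iff)
  moreover have "inj_on ?h (K \<times> polys_below K d)"
    by (auto simp: inj_on_def)
  ultimately show ?case
    using Suc assms by (simp add: card_image card_cartesian_product)
qed

context field_of_order
begin

lemma sub_sum: "(\<And>i. i \<in> I \<Longrightarrow> (f i :: 'a) \<in> sub q m) \<Longrightarrow> sum f I \<in> sub q m"
  by (induction I rule: infinite_finite_induct) (auto intro: sub_add)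

abbreviation polys :: "nat \<Rightarrow> 'a poly set" where
  "polys m \<equiv> {f. \<forall>i. coeff f i \<in> sub q m}"

lemma polys_mult: "f \<in> polys m \<Longrightarrow> h \<in> polys m \<Longrightarrow> f * h \<in> polys m"
  by (auto simp: coeff_mult intro!: sub_sum sub_mult)

lemma polys_add: "f \<in> polys m \<Longrightarrow> h \<in> polys m \<Longrightarrow> f + h \<in> polys m"
  by (auto intro: sub_add)

lemma polys_uminus: "f \<in> polys m \<Longrightarrow> - f \<in> polys m"
  by (auto intro: sub_uminus)

lemma polys_power: "f \<in> polys m \<Longrightarrow> f ^ i \<in> polys m"
proof (induction i)
  case (Suc i)
  then show ?case
    using polys_mult[of f m "f ^ i"] by simp
qed (auto simp: coeff_1)

text \<open>Inversion in a finite field is a power, which closes the set of polynomial values at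
  \<open>g\<close> under inverses.\<close>

lemma inverse_eq_power:
  assumes "(x::'a) \<noteq> 0"
  shows "inverse x = x ^ (q ^ n - 2)"
proof -
  have "Suc (Suc (q ^ n - 2)) = q ^ n"
    using power_gt1[OF n_pos] by linarith
  then have "x * (x * x ^ (q ^ n - 2)) = x"
    by (metis power_Suc power_q_n)
  then have "x * x ^ (q ^ n - 2) = 1"
    using assms by simp
  then show ?thesis
    by (simp add: inverse_unique)
qed

lemma is_subfield_adjoin: "is_subfield ((\<lambda>h. poly h (g::'a)) ` polys m)" (is "is_subfield ?R")
  unfolding is_subfield_def
proof (intro conjI ballI)
  show "0 \<in> ?R"
    by (intro image_eqI[of _ _ 0]) auto
  show "1 \<in> ?R"
    by (intro image_eqI[of _ _ 1]) (auto simp: coeff_1)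
next
  fix x y
  assume "x \<in> ?R" "y \<in> ?R"
  then obtain f h where *: "x = poly f g" "y = poly h g" "f \<in> polys m" "h \<in> polys m"
    by blast
  show "x + y \<in> ?R"
    using * polys_add[of f m h] by (intro image_eqI[of _ _ "f + h"]) auto
  show "x * y \<in> ?R"
    using * polys_mult[of f m h] by (intro image_eqI[of _ _ "f * h"]) auto
next
  fix x
  assume "x \<in> ?R"
  then obtain f where *: "x = poly f g" "f \<in> polys m"
    by blast
  show "- x \<in> ?R"
    using * polys_uminus[of f m] by (intro image_eqI[of _ _ "- f"]) auto
  show "inverse x \<in> ?R"
  proof (cases "x = 0")
    case True
    then show ?thesis
      by (intro image_eqI[of _ _ 0]) auto
  next
    case False
    then show ?thesis
      using * polys_power[of f m "q ^ n - 2"] inverse_eq_power[OF False]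
      by (intro image_eqI[of _ _ "f ^ (q ^ n - 2)"]) auto
  qed
qed

text \<open>Division with remainder by \<open>f\<close>, carried out on values at \<open>g\<close>:
  since \<open>f\<close> vanishes there, \<open>g ^ degree f\<close> is a combination of lower
  powers.\<close>

lemma adjoin_subset:
  assumes f: "f \<in> polys m" "f \<noteq> 0" "poly f (g::'a) = 0" and h: "h \<in> polys m"
  shows "poly h g \<in> (\<lambda>h. poly h g) ` polys_below (sub q m) (degree f)"
proof -
  define d c where "d = degree f" and "c = lead_coeff f"
  let ?S = "(\<lambda>h. poly h g) ` polys_below (sub q m) d"
  have c: "c \<noteq> 0" "c \<in> sub q m"
    using f by (auto simp: c_def)
  \<comment> \<open>Solving \<open>poly f g = 0\<close> for the leading term expresses
    \<open>g ^ d\<close> as the value of \<open>h0\<close>, which has only terms below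
    \<open>d\<close>.\<close>
  define h0 where "h0 = smult (- 1 / c) (f - monom c d)"
  have h0: "poly h0 g = g ^ d"
    using f c by (simp add: h0_def poly_monom)
  have h0_in: "h0 \<in> polys_below (sub q m) d"
    using f c coeff_eq_0[of f]
    by (auto simp: h0_def polys_below_def c_def[symmetric] d_def le_less
        intro!: sub_mult sub_diff sub_divide sub_uminus)
  have step: "poly (pCons a h) g \<in> ?S" if "a \<in> sub q m" "h \<in> polys_below (sub q m) d" for a h
  proof -
    \<comment> \<open>Prepending a coefficient shifts degrees up by one, so only the term of degree
      \<open>d\<close> can overflow; \<open>b\<close> is its coefficient, and \<open>h0\<close>
      replaces the monomial.\<close>
    define b where "b = coeff (pCons a h) d"
    have in_d: "pCons a h \<in> polys_below (sub q m) (Suc d)"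
      using that by (simp add: pCons_in_polys_below_iff)
    then have "b \<in> sub q m"
      unfolding b_def by (rule polys_below_coeff)
    moreover have "coeff (pCons a h) i = 0" if "d < i" for i
      using polys_below_coeff_0[OF in_d] that by simp
    ultimately have "pCons a h - monom b d + smult b h0 \<in> polys_below (sub q m) d"
      using polys_below_coeff[OF in_d] h0_in
      by (auto simp: polys_below_def b_def le_less intro!: sub_mult sub_diff sub_add)
    moreover have "poly (pCons a h - monom b d + smult b h0) g = poly (pCons a h) g"
      by (simp add: h0 poly_monom)
    ultimately show ?thesis
      by (metis image_eqI)
  qed
  have "poly h g \<in> ?S"
    using h
  proof (induction h)
    case 0
    show ?case
      by (intro image_eqI[of _ _ 0]) (auto simp: polys_below_def)
  next
    case (pCons a h)
    have a: "a \<in> sub q m" and "h \<in> polys m"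
      using pCons.prems by (auto simp: coeff_pCons split: nat.splits dest: spec[of _ "Suc _"])
    with pCons.IH obtain h1 where h1: "h1 \<in> polys_below (sub q m) d" "poly h g = poly h1 g"
      by auto
    then show ?case
      using step[OF a h1(1)] by simp
  qed
  then show ?thesis
    by (simp add: d_def)
qed

text \<open>For nonzero \<open>f\<close>, the values at \<open>g\<close> of polynomials with fewer
  than \<open>p\<close> coefficients would cover all of \<open>sub q (p * m)\<close>, which is too
  large.\<close>

lemma generates_independent:
  assumes g: "generates q m (p * m) (g::'a)" and p: "0 < p" and m: "0 < m" "p * m dvd n"
    and f: "f \<in> polys_below (sub q m) p" "poly f g = 0"
  shows "f = 0"
proof (rule ccontr)
  assume "f \<noteq> 0"
  have fm: "f \<in> polys m"
    using f by (auto simp: polys_below_def)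
  have d: "degree f < p"
    using f \<open>f \<noteq> 0\<close> polys_below_coeff_0[OF f(1), of "degree f"] by (meson leading_coeff_0_iff not_less)
  let ?R = "(\<lambda>h. poly h g) ` polys m"
  have "sub q m \<subseteq> ?R"
  proof
    fix x :: 'a
    assume "x \<in> sub q m"
    then show "x \<in> ?R"
      by (intro image_eqI[of _ _ "[:x:]"]) (auto simp: coeff_pCons split: nat.splits)
  qed
  moreover have "g \<in> ?R"
    by (intro image_eqI[of _ _ "[:0, 1:]"]) (auto simp: coeff_pCons split: nat.splits)
  ultimately have "sub q (p * m) \<subseteq> ?R"
    using g is_subfield_adjoin unfolding generates_def by blast
  also have "\<dots> \<subseteq> (\<lambda>h. poly h g) ` polys_below (sub q m) (degree f)"
    using adjoin_subset[OF fm \<open>f \<noteq> 0\<close> f(2)] by blast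
  finally have "card (sub q (p * m) :: 'a set) \<le> card ((\<lambda>h. poly h g) ` polys_below (sub q m) (degree f))"
    by (intro card_mono) (simp_all add: card_polys_below)
  also have "\<dots> \<le> card (polys_below (sub q m :: 'a set) (degree f))"
    by (intro card_image_le) (simp add: card_polys_below)
  also have "\<dots> = q ^ (m * degree f)"
    using card_sub[of m] m by (simp add: card_polys_below power_mult dvd_mult_right)
  also have "\<dots> < q ^ (p * m)"
    using d m q_ge2 by (intro power_strict_increasing) auto
  finally show False
    using card_sub[of "p * m"] m p by simp
qed

lemma generates_poly_eq:
  assumes g: "generates q m (p * m) (g::'a)" and p: "0 < p" and m: "0 < m" "p * m dvd n"
    and f: "f \<in> polys_below (sub q m) p" "h \<in> polys_below (sub q m) p" "poly f g = poly h g"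
  shows "f = h"
proof -
  have "f - h \<in> polys_below (sub q m) p"
    using f by (auto simp: polys_below_def intro: sub_diff)
  then show ?thesis
    using generates_independent[OF g p m, of "f - h"] f by simp
qed

text \<open>The powers below \<open>q ^ m - 1\<close> reach all \<open>q ^ m - 1\<close> nonzero
  elements, so no value can occur twice.\<close>

lemma primitive_power_inj:
  assumes w: "primitive_elem q m (w::'a)" and m: "0 < m" "m dvd n"
  shows "inj_on (\<lambda>i. w ^ i) {..<q ^ m - 1}"
proof -
  let ?N = "q ^ m - 1"
  have w0: "w \<noteq> 0" "w ^ (q ^ m) = w"
    using w by (auto simp: primitive_elem_def sub_def)
  have N: "Suc ?N = q ^ m"
    using power_gt1[OF m(1)] by simp
  have wN: "w ^ ?N = 1"
    using w0 N by (metis mult_cancel_left mult.right_neutral power_Suc)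
  have "sub q m - {0} \<subseteq> (\<lambda>i. w ^ i) ` {..<?N}"
  proof
    fix x :: 'a
    assume "x \<in> sub q m - {0}"
    then obtain i where i: "x = w ^ i"
      using w unfolding primitive_elem_def by blast
    have "w ^ i = w ^ (?N * (i div ?N) + i mod ?N)"
      by simp
    then have "w ^ i = w ^ (i mod ?N)"
      unfolding power_add power_mult wN by simp
    then show "x \<in> (\<lambda>i. w ^ i) ` {..<?N}"
      using power_gt1[OF m(1)] i by auto
  qed
  then have "card (sub q m - {0::'a}) \<le> card ((\<lambda>i. w ^ i) ` {..<?N})"
    by (intro card_mono) auto
  moreover have "card (sub q m - {0::'a}) = ?N"
    using card_sub[OF m(2,1)] by simp
  ultimately show ?thesis
    by (intro eq_card_imp_inj_on antisym card_image_le) auto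
qed

end

subsection \<open>Block maps as polynomials\<close>

text \<open>Only the first summand has a term of degree \<open>Suc l'\<close>, and its coefficient
  there is \<open>A\<close>.\<close>

lemma coeff_eq_0_of_monom_relation:
  fixes P P' :: "'a::field poly"
  assumes E: "smult A (P * monom 1 (Suc l')) + smult B (P' * monom 1 (Suc l)) + monom c (Suc l + Suc l') = 0"
    and "coeff P 0 = 1" "l' < l"
  shows "A = 0"
  using arg_cong[OF E, of "\<lambda>f. coeff f (Suc l')"] assms(2,3)
  by (simp add: coeff_monom_mult mult.commute[of _ "monom _ _"])

text \<open>Lowest-order terms force \<open>l = l'\<close>. Cancelling \<open>X^(l+1)\<close> leaves
  \<open>A P + B P' + c X^(l+1) = 0\<close>: the constant term gives \<open>A + B = 0\<close>, the
  term beyond both degrees gives \<open>c = 0\<close>, and the rest gives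
  \<open>P = P'\<close>.\<close>

lemma monom_relation_trivial:
  fixes P P' :: "'a::field poly"
  assumes E: "smult A (P * monom 1 (Suc l')) + smult B (P' * monom 1 (Suc l)) + monom c (Suc l + Suc l') = 0"
    and P: "coeff P 0 = 1" "degree P \<le> l" and P': "coeff P' 0 = 1" "degree P' \<le> l'"
    and A: "A \<noteq> 0" and B: "B \<noteq> 0"
  shows "l = l' \<and> P = P' \<and> A + B = 0 \<and> c = 0"
proof -
  have "\<not> l' < l"
    using coeff_eq_0_of_monom_relation[OF E] P A by blast
  moreover have "\<not> l < l'"
    using coeff_eq_0_of_monom_relation[of B P' l A P l' c] E P' B by (auto simp: algebra_simps)
  ultimately have l: "l = l'"
    by simp
  have c: "A * coeff P i + B * coeff P' i + (if i = Suc l then c else 0) = 0" for i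
    using arg_cong[OF E, of "\<lambda>f. coeff f (Suc l + i)"]
    by (auto simp: l coeff_monom_mult mult.commute[of _ "monom _ _"] split: if_splits)
  have AB: "A + B = 0"
    using c[of 0] P P' by simp
  have "c = 0"
    using c[of "Suc l"] coeff_eq_0[of P "Suc l"] coeff_eq_0[of P' "Suc l"] P P' l by simp
  moreover have "coeff P i = coeff P' i" for i
  proof -
    have "B = - A"
      using AB by (simp add: add_eq_0_iff)
    with c[of i] \<open>c = 0\<close> have "A * coeff P i = A * coeff P' i"
      by auto
    with A show ?thesis
      by simp
  qed
  ultimately show ?thesis
    using l AB by (simp add: poly_eq_iff)
qed

text \<open>Once the constant terms agree, the multiples of \<open>P P'\<close> cancel. What remains
  is the relation treated above, with \<open>A = u1 t2 - u2 t1\<close>,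
  \<open>B = s1 v2 - s2 v1\<close> and \<open>c = s1 t2 - s2 t1\<close>.\<close>

lemma product_relation_trivial:
  fixes P P' :: "'a::field poly"
  assumes E: "(smult u1 P + monom s1 (Suc l)) * (smult v2 P' + monom t2 (Suc l'))
      = (smult u2 P + monom s2 (Suc l)) * (smult v1 P' + monom t1 (Suc l'))"
    and P: "coeff P 0 = 1" "degree P \<le> l" and P': "coeff P' 0 = 1" "degree P' \<le> l'"
  shows "u1 * v2 = u2 * v1"
    and "u1 * t2 \<noteq> u2 * t1 \<Longrightarrow> s1 * v2 \<noteq> s2 * v1 \<Longrightarrow>
      l = l' \<and> P = P' \<and> u1 * t2 - u2 * t1 + (s1 * v2 - s2 * v1) = 0 \<and> s1 * t2 = s2 * t1"
proof -
  show uv: "u1 * v2 = u2 * v1"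
    using arg_cong[OF E, of "\<lambda>f. coeff f 0"] P P' by (simp add: coeff_mult_0)
  have uv': "[:u1:] * [:v2:] = [:u2:] * [:v1:]"
    using uv by (simp add: mult.commute)
  \<comment> \<open>Scalars and monomials become products with constant polynomials, so that the
    expansion below is an identity in a commutative ring.\<close>
  have split: "smult a f = [:a:] * f" "monom a i = [:a:] * monom 1 i" for a :: 'a and f i
    by (simp_all add: smult_monom)
  have E': "([:u1:] * P + [:s1:] * monom 1 (Suc l)) * ([:v2:] * P' + [:t2:] * monom 1 (Suc l'))
      = ([:u2:] * P + [:s2:] * monom 1 (Suc l)) * ([:v1:] * P' + [:t1:] * monom 1 (Suc l'))"
    using E by (simp only: split(1) split(2)[of s1] split(2)[of s2] split(2)[of t1] split(2)[of t2])
  have "([:u1:] * [:t2:] - [:u2:] * [:t1:]) * (P * monom 1 (Suc l'))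
      + ([:s1:] * [:v2:] - [:s2:] * [:v1:]) * (P' * monom 1 (Suc l))
      + ([:s1:] * [:t2:] - [:s2:] * [:t1:]) * (monom 1 (Suc l) * monom 1 (Suc l'))
      = ([:u1:] * P + [:s1:] * monom 1 (Suc l)) * ([:v2:] * P' + [:t2:] * monom 1 (Suc l'))
      - ([:u2:] * P + [:s2:] * monom 1 (Suc l)) * ([:v1:] * P' + [:t1:] * monom 1 (Suc l'))
      - ([:u1:] * [:v2:] - [:u2:] * [:v1:]) * P * P'"
    by (simp only: ring_distribs mult_ac add_ac diff_conv_add_uminus minus_add_distrib
        minus_mult_left[symmetric] minus_mult_right[symmetric] minus_minus) (simp add: algebra_simps)
  also have "\<dots> = 0"
    unfolding E' uv' by simp
  finally have "smult (u1 * t2 - u2 * t1) (P * monom 1 (Suc l'))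
      + smult (s1 * v2 - s2 * v1) (P' * monom 1 (Suc l))
      + monom (s1 * t2 - s2 * t1) (Suc l + Suc l') = 0"
    by (simp add: mult_monom smult_monom mult.commute)
  then show "u1 * t2 \<noteq> u2 * t1 \<Longrightarrow> s1 * v2 \<noteq> s2 * v1 \<Longrightarrow>
      l = l' \<and> P = P' \<and> u1 * t2 - u2 * t1 + (s1 * v2 - s2 * v1) = 0 \<and> s1 * t2 = s2 * t1"
    using monom_relation_trivial[of _ P l' _ P' l] P P' by fastforce
qed

text \<open>An index \<open>(l, f, a, j)\<close> stands for \<open>\<ell>_1 = l\<close> and \<open>P = 1 + X f\<close>; the length \<open>\<ell>_0\<close> of the tuple
  \<open>\<alpha>\<close> is the degree of \<open>P\<close>, so it need not be recorded.\<close>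

type_synonym 'a block_index = "nat \<times> 'a poly \<times> 'a \<times> nat"

text \<open>The bound on \<open>f\<close> says that \<open>1 + X f\<close> has degree at most
  \<open>l\<close>, which is the condition on the two lengths in the construction.\<close>

definition block_indices :: "nat \<Rightarrow> nat \<Rightarrow> nat \<Rightarrow> 'a::{field,finite} block_index set" where
  "block_indices q p m = {(l, f, a, j). l \<le> (p - 3) div 2 \<and> f \<in> polys_below (sub q m) l
      \<and> a \<in> sub q m \<and> j \<le> q - 2}"

text \<open>Keeping an indeterminate in place of \<open>g\<close> allows images to be compared
  coefficientwise; evaluation happens only in \<open>block_map\<close>.\<close>

fun block_poly :: "nat \<Rightarrow> 'a::{field,finite} \<Rightarrow> 'a block_index \<Rightarrow> 'a \<Rightarrow> 'a poly" where
  "block_poly q w (l, f, a, j) u = smult u (pCons 1 f) + monom (w ^ j * (u ^ q + a * u)) (Suc l)"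

definition block_map :: "nat \<Rightarrow> 'a::{field,finite} \<Rightarrow> 'a \<Rightarrow> 'a block_index \<Rightarrow> 'a \<Rightarrow> 'a" where
  "block_map q w g h u = poly (block_poly q w h u) g"

lemma block_map_altdef:
  "block_map q w g (l, f, a, j) u = u * (1 + g * poly f g) + w ^ j * (u ^ q + a * u) * g ^ Suc l"
  by (simp add: block_map_def poly_monom algebra_simps)

context field_of_order
begin

text \<open>A nonempty tuple with nonzero last entry is the coefficient list of an \<open>f\<close>
  of degree one less than its length; the empty tuple is \<open>f = 0\<close>.\<close>

lemma block_fam_eq: "block_fam q p m w (g::'a) = block_map q w g ` block_indices q p m"
proof (intro equalityI subsetI)
  fix \<Phi>
  assume "\<Phi> \<in> block_fam q p m w g"
  then obtain l0 \<alpha> a jj l1 where \<Phi>: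
      "\<Phi> = (\<lambda>u. u * (1 + (\<Sum>i=1..l0. \<alpha> i * g ^ i)) + w ^ jj * (u ^ q + a * u) * g ^ (l1 + 1))"
    and h: "\<forall>i\<in>{1..<l0}. \<alpha> i \<in> sub q m" "0 < l0 \<longrightarrow> \<alpha> l0 \<in> sub q m - {0}"
      "a \<in> sub q m" "jj \<le> q - 2" "l0 \<le> l1" "l1 \<le> (p - 3) div 2"
    unfolding block_fam_def by blast
  have \<alpha>: "\<alpha> (Suc i) \<in> sub q m" if "i < l0" for i
    using h(1,2) that by (cases "Suc i = l0") auto
  define f where "f = (\<Sum>i<l0. monom (\<alpha> (Suc i)) i)"
  have cf: "coeff f i = (if i < l0 then \<alpha> (Suc i) else 0)" for i
    by (simp add: f_def coeff_sum sum.delta)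
  have "f \<in> polys_below (sub q m) l1"
    using \<alpha> h by (auto simp: polys_below_def cf)
  moreover have "g * poly f g = (\<Sum>i=1..l0. \<alpha> i * g ^ i)"
    by (simp add: f_def poly_sum poly_monom sum_distrib_left sum.atLeast1_atMost_eq
        mult.left_commute atLeast0LessThan)
  ultimately show "\<Phi> \<in> block_map q w g ` block_indices q p m"
    using h by (intro image_eqI[of _ _ "(l1, f, a, jj)"])
      (auto simp: \<Phi> block_map_altdef block_indices_def fun_eq_iff)
next
  fix \<Phi>
  assume "\<Phi> \<in> block_map q w g ` block_indices q p m"
  then obtain l f a j where \<Phi>: "\<Phi> = block_map q w g (l, f, a, j)" and h: "l \<le> (p - 3) div 2"
    "f \<in> polys_below (sub q m) l" "a \<in> sub q m" "j \<le> q - 2"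
    by (auto simp: block_indices_def)
  \<comment> \<open>This is the degree of \<open>1 + X f\<close>; the zero polynomial needs its own
    case because \<open>degree 0 = 0\<close>.\<close>
  define l0 where "l0 = (if f = 0 then 0 else Suc (degree f))"
  define \<alpha> where "\<alpha> i = coeff f (i - 1)" for i
  have "poly f g = (\<Sum>i<l0. coeff f i * g ^ i)"
    by (auto simp: l0_def poly_altdef lessThan_Suc_atMost)
  then have l0_sum: "g * poly f g = (\<Sum>i=1..l0. \<alpha> i * g ^ i)"
    by (simp add: \<alpha>_def sum_distrib_left sum.atLeast1_atMost_eq mult.left_commute atLeast0LessThan)
  have l0_le: "l0 \<le> l"
    using h(2) polys_below_coeff_0[OF h(2), of "degree f"]
    by (auto simp: l0_def) (meson leading_coeff_0_iff not_less_eq_eq)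
  have \<alpha>_in: "\<alpha> i \<in> sub q m" for i
    using h(2) by (simp add: \<alpha>_def polys_below_coeff)
  have \<alpha>_nz: "0 < l0 \<longrightarrow> \<alpha> l0 \<noteq> 0"
    by (auto simp: l0_def \<alpha>_def)
  show "\<Phi> \<in> block_fam q p m w g"
    unfolding block_fam_def
    by (rule CollectI, rule exI[of _ l0], rule exI[of _ \<alpha>], rule exI[of _ a], rule exI[of _ j],
        rule exI[of _ l])
      (use h l0_sum l0_le \<alpha>_in \<alpha>_nz in \<open>auto simp: \<Phi> block_map_altdef fun_eq_iff\<close>)
qed

end

subsection \<open>Separation\<close>

context field_of_order
begin

lemma block_poly_add:
  "block_poly q w h ((u::'a) + v) = block_poly q w h u + block_poly q w h v"
proof -
  have "(u + v) ^ q = u ^ q + v ^ q"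
    using frobenius_add[of u v 1] by simp
  then show ?thesis
    by (cases h) (simp add: algebra_simps smult_add_left flip: add_monom)
qed

lemma block_poly_scale:
  assumes "c \<in> sub q 1"
  shows "block_poly q w h (c * (u::'a)) = smult c (block_poly q w h u)"
proof -
  have "c ^ q = c"
    using assms by (simp only: sub1_eq)
  then show ?thesis
    by (cases h) (simp add: power_mult_distrib algebra_simps smult_add_right smult_monom)
qed

lemma block_map_add: "block_map q w g h ((u::'a) + v) = block_map q w g h u + block_map q w g h v"
  by (simp add: block_map_def block_poly_add)

lemma block_map_scale: "c \<in> sub q 1 \<Longrightarrow> block_map q w g h (c * (u::'a)) = c * block_map q w g h u"
  by (simp add: block_map_def block_poly_scale)

lemma block_map_0 [simp]: "block_map q w g h (0::'a) = 0"
  using block_map_scale[of 0 w g h 0] by simp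

lemma coeff_block_poly_0 [simp]: "coeff (block_poly q w h u) 0 = (u::'a)"
  by (cases h) simp

text \<open>The bound allows degree up to \<open>(p - 3) div 2 + 1\<close>. For odd \<open>p\<close>
  at least 3, twice this is \<open>p - 1\<close>, so products of two such polynomials stay where
  powers of the generator are independent.\<close>

lemma block_poly_in:
  assumes "h \<in> block_indices q p m" "(u::'a) \<in> sub q m" "w \<in> sub q m"
  shows "block_poly q w h u \<in> polys_below (sub q m) ((p - 3) div 2 + 2)"
proof -
  obtain l f a j where h: "h = (l, f, a, j)"
    by (cases h)
  have P: "pCons 1 f \<in> polys_below (sub q m) (Suc l)" and l: "l \<le> (p - 3) div 2"
    using assms by (auto simp: h block_indices_def pCons_in_polys_below_iff)
  have "u ^ q \<in> sub q m" "w ^ j \<in> sub q m" "a \<in> sub q m"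
    using assms by (auto simp: h block_indices_def intro: sub_power)
  with assms have s: "w ^ j * (u ^ q + a * u) \<in> sub q m"
    by (intro sub_mult sub_add) auto
  have "coeff (block_poly q w h u) i
      = u * coeff (pCons 1 f) i + (if i = Suc l then w ^ j * (u ^ q + a * u) else 0)" for i
    by (simp add: h del: smult_pCons)
  then show ?thesis
    using polys_below_coeff[OF P] polys_below_coeff_0[OF P] s l assms(2)
    unfolding polys_below_def by (auto simp del: coeff_pCons_Suc intro: sub_add sub_mult)
qed

lemma polys_below_mult:
  fixes f h :: "'a poly"
  assumes "f \<in> polys_below (sub q m) (Suc d)" "h \<in> polys_below (sub q m) (Suc e)"
  shows "f * h \<in> polys_below (sub q m) (Suc (d + e))"
proof -
  have "degree f \<le> d" "degree h \<le> e"
    using assms by (auto simp: polys_below_def intro!: degree_le)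
  then have "degree (f * h) \<le> d + e"
    using degree_mult_le[of f h] by linarith
  then have "coeff (f * h) i = 0" if "Suc (d + e) \<le> i" for i
    using that by (intro coeff_eq_0) auto
  moreover have "f * h \<in> polys m"
    using assms by (intro polys_mult) (auto simp: polys_below_def)
  ultimately show ?thesis
    by (auto simp: polys_below_def)
qed

end

locale block = field_of_order q n ty
  for q n :: nat and ty :: "'a::{field,finite} itself" +
  fixes p m :: nat and w g :: 'a
  assumes p: "odd p" "3 \<le> p" and m: "0 < m" "p * m dvd n"
    and w: "primitive_elem q m w" and g: "generates q m (p * m) g"
begin

lemma m_dvd: "m dvd n"
  using m(2) by (rule dvd_mult_right)

lemma w_in: "w \<in> sub q m" and w_nz: "w \<noteq> 0"
  using w by (auto simp: primitive_elem_def)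

lemma g_in: "g \<in> sub q (p * m)"
  using g by (simp add: generates_def)

lemma half_p: "2 * ((p - 3) div 2) + 3 = p"
  using p by (auto elim!: oddE)

text \<open>The constant coefficient of the block polynomial is \<open>u\<close> itself, so
  independence of the powers of \<open>g\<close> makes the kernel trivial.\<close>

lemma block_map_eq_0:
  assumes "h \<in> block_indices q p m" "u \<in> sub q m" "block_map q w g h u = 0"
  shows "u = 0"
proof -
  have "block_poly q w h u \<in> polys_below (sub q m) p"
    using block_poly_in[OF assms(1,2) w_in] polys_below_mono[of "(p - 3) div 2 + 2" p] half_p
    by force
  then have "block_poly q w h u = 0"
    using generates_independent[OF g _ m] assms(3) p by (simp add: block_map_def)
  then show ?thesis
    using coeff_block_poly_0[of w h u] by simp
qed

lemma block_map_in:
  assumes "h \<in> block_indices q p m" "u \<in> sub q m"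
  shows "block_map q w g h u \<in> sub q (p * m)"
proof -
  have "coeff (block_poly q w h u) i * g ^ i \<in> sub q (p * m)" for i
    using polys_below_coeff[OF block_poly_in[OF assms w_in]] sub_mono[of m "p * m"] g_in
    by (intro sub_mult sub_power) auto
  then show ?thesis
    unfolding block_map_def poly_altdef by (intro sub_sum)
qed

lemma inj_on_block_map:
  assumes h: "h \<in> block_indices q p m"
  shows "inj_on (block_map q w g h) (sub q m)"
proof (rule inj_onI)
  fix u v
  assume uv: "u \<in> sub q m" "v \<in> sub q m" "block_map q w g h u = block_map q w g h v"
  have "block_map q w g h (u - v) = 0"
    using block_map_add[of w g h "u - v" v] uv(3) by simp
  then show "u = v"
    using block_map_eq_0[OF h, of "u - v"] uv by (simp add: sub_diff)
qed

text \<open>Raising to the power \<open>c = (q^m - 1) / (q - 1)\<close>, the norm to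
  \<open>F_q\<close>, turns \<open>x ^ (q - 1)\<close> into 1. Then \<open>w ^ (j * c)\<close> and
  \<open>w ^ (j' * c)\<close> agree, and the range of \<open>j\<close> keeps both exponents below
  the order of \<open>w\<close>.\<close>

lemma power_ratio_index_eq:
  assumes x: "x \<in> sub q m" "x \<noteq> 0" and eq: "x ^ q * w ^ j' = x * w ^ j"
    and j: "j \<le> q - 2" "j' \<le> q - 2"
  shows "j = j'"
proof -
  obtain c where c: "q ^ m - 1 = (q - 1) * c"
    using power_diff_dvd_nat[of 1 m q] by (auto simp: dvd_def)
  have N: "1 < q ^ m"
    using power_gt1[OF m(1)] .
  then have "0 < (q - 1) * c"
    unfolding c[symmetric] by simp
  then have c0: "0 < c"
    by simp
  have "x ^ q = x * x ^ (q - 1)"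
    using q_ge2 by (simp flip: power_Suc)
  with eq x have e: "x ^ (q - 1) * w ^ j' = w ^ j"
    by (simp add: mult.assoc)
  have xN: "x ^ (q ^ m - 1) = 1"
  proof -
    have "Suc (q ^ m - 1) = q ^ m"
      using N by linarith
    then have "x * x ^ (q ^ m - 1) = x ^ (q ^ m)"
      by (metis power_Suc)
    then show ?thesis
      using x by (simp add: sub_def)
  qed
  have "w ^ (j * c) = (x ^ (q - 1) * w ^ j') ^ c"
    by (simp only: e power_mult)
  also have "\<dots> = w ^ (j' * c)"
    by (simp only: power_mult_distrib power_mult[symmetric] xN[unfolded c] mult_1_left)
  finally have "w ^ (j * c) = w ^ (j' * c)" .
  moreover have "i * c < q ^ m - 1" if "i \<le> q - 2" for i
    unfolding c using that c0 q_ge2 by simp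
  ultimately have "j * c = j' * c"
    using inj_onD[OF primitive_power_inj[OF w m(1) m_dvd], of "j * c" "j' * c"] j by blast
  then show ?thesis
    using c0 by simp
qed

text \<open>Cross-multiplication removes \<open>\<beta>\<close>. Then \<open>l\<close> and
  \<open>P\<close> come from the low-order terms, \<open>j\<close> from the norm argument,
  \<open>a\<close> from the top coefficient, and finally \<open>\<beta>\<close> as the ratio
  \<open>v2 / u2\<close>.\<close>

lemma block_map_separates:
  assumes h: "h \<in> block_indices q p m" and h': "h' \<in> block_indices q p m"
    and u: "u1 \<in> sub q m" "u2 \<in> sub q m" "u2 \<noteq> 0" "u1 / u2 \<notin> sub q 1"
    and v: "v1 \<in> sub q m" "v2 \<in> sub q m" and \<beta>: "\<beta> \<noteq> 0"
    and eq: "\<beta> * block_map q w g h u1 = block_map q w g h' v1"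
      "\<beta> * block_map q w g h u2 = block_map q w g h' v2"
  shows "h = h' \<and> \<beta> \<in> sub q 1"
proof -
  obtain l f a j where hd: "h = (l, f, a, j)"
    by (cases h)
  obtain l' f' a' j' where hd': "h' = (l', f', a', j')"
    by (cases h')
  define P P' where "P = pCons 1 f" and "P' = pCons 1 f'"
  define s where "s x = w ^ j * (x ^ q + a * x)" for x
  define t where "t x = w ^ j' * (x ^ q + a' * x)" for x
  have Phi: "block_poly q w h x = smult x P + monom (s x) (Suc l)"
    "block_poly q w h' x = smult x P' + monom (t x) (Suc l')" for x
    by (simp_all add: hd hd' P_def P'_def s_def t_def)
  have P: "coeff P 0 = 1" "degree P \<le> l" "coeff P' 0 = 1" "degree P' \<le> l'"
    using h h' by (auto simp: hd hd' P_def P'_def block_indices_def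
        dest!: polys_below_degree_pCons simp del: degree_pCons_eq_if)
  have v2: "v2 \<noteq> 0"
    using block_map_eq_0[OF h u(2)] u(3) \<beta> eq(2) by auto
  have "\<beta> * (block_map q w g h u1 * block_map q w g h' v2)
      = \<beta> * (block_map q w g h u2 * block_map q w g h' v1)"
    unfolding eq[symmetric] by simp
  then have "poly (block_poly q w h u1 * block_poly q w h' v2) g
      = poly (block_poly q w h u2 * block_poly q w h' v1) g"
    using \<beta> by (simp add: block_map_def)
  moreover have "block_poly q w h x * block_poly q w h' y \<in> polys_below (sub q m) p"
    if "x \<in> sub q m" "y \<in> sub q m" for x y
  proof -
    define d where "d = (p - 3) div 2"
    have d: "(p - 3) div 2 + 2 = Suc (Suc d)" "Suc (Suc d + Suc d) = p"
      using half_p by (simp_all add: d_def)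
    show ?thesis
      using polys_below_mult[OF block_poly_in[OF h that(1) w_in, unfolded d(1)]
          block_poly_in[OF h' that(2) w_in, unfolded d(1)]]
      unfolding d(2) .
  qed
  ultimately have "block_poly q w h u1 * block_poly q w h' v2
      = block_poly q w h u2 * block_poly q w h' v1"
    using u v p by (intro generates_poly_eq[OF g _ m]) auto
  note rel = product_relation_trivial[OF this[unfolded Phi] P]
  \<comment> \<open>By the constant terms \<open>\<kappa>\<close> is also \<open>v1 / v2\<close>;
    that it lies outside \<open>F_q\<close> keeps both differences \<open>A\<close> and
    \<open>B\<close> below nonzero.\<close>
  define \<kappa> where "\<kappa> = u1 / u2"
  have u1: "u1 = \<kappa> * u2"
    using u by (simp add: \<kappa>_def)
  have v1: "v1 = \<kappa> * v2"
    using rel(1) u(3) by (simp add: u1)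
  have \<kappa>: "\<kappa> ^ q \<noteq> \<kappa>"
    using u(4) unfolding \<kappa>_def sub1_eq .
  have A: "u1 * t v2 - u2 * t v1 = u2 * v2 ^ q * w ^ j' * (\<kappa> - \<kappa> ^ q)"
    unfolding u1 v1 t_def by (simp add: algebra_simps power_mult_distrib)
  have B: "s u1 * v2 - s u2 * v1 = u2 ^ q * v2 * w ^ j * (\<kappa> ^ q - \<kappa>)"
    unfolding u1 v1 s_def by (simp add: algebra_simps power_mult_distrib)
  have "u1 * t v2 - u2 * t v1 \<noteq> 0" "s u1 * v2 - s u2 * v1 \<noteq> 0"
    unfolding A B using u(3) v2 w_nz \<kappa> by auto
  then have *: "l = l'" "P = P'" "u1 * t v2 - u2 * t v1 + (s u1 * v2 - s u2 * v1) = 0"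
    "s u1 * t v2 = s u2 * t v1"
    using rel(2) by auto
  \<comment> \<open>This ratio satisfies the equation of \<open>power_ratio_index_eq\<close>, which
    first gives \<open>j = j'\<close> and then \<open>\<mu> ^ q = \<mu>\<close>.\<close>
  define \<mu> where "\<mu> = v2 / u2"
  have v2': "v2 = \<mu> * u2"
    using u(3) by (simp add: \<mu>_def)
  have "(\<kappa> - \<kappa> ^ q) * (u2 * v2 ^ q * w ^ j' - u2 ^ q * v2 * w ^ j) = 0"
    using *(3) unfolding A B by (simp add: algebra_simps)
  then have "u2 * v2 ^ q * w ^ j' = u2 ^ q * v2 * w ^ j"
    using \<kappa> by auto
  then have \<mu>w: "\<mu> ^ q * w ^ j' = \<mu> * w ^ j"
    using u(3) by (simp add: v2' power_mult_distrib)
  have \<mu>: "\<mu> \<in> sub q m" "\<mu> \<noteq> 0"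
    using u v v2 by (auto simp: \<mu>_def intro: sub_divide)
  have j: "j = j'"
    using power_ratio_index_eq[OF \<mu> \<mu>w] h h' by (auto simp: hd hd' block_indices_def)
  have \<mu>q: "\<mu> ^ q = \<mu>"
    using \<mu>w w_nz by (simp add: j)
  \<comment> \<open>With \<open>\<mu>\<close> fixed by the \<open>q\<close>-th power, the top
    coefficient is a nonzero multiple of \<open>a' - a\<close>.\<close>
  have "(s u1 * t v2 - s u2 * t v1)
      = w ^ j * w ^ j * \<mu> * u2 * u2 ^ q * (a' - a) * (\<kappa> ^ q - \<kappa>)"
    unfolding s_def t_def v1 u1 v2' power_mult_distrib \<mu>q j by (simp add: algebra_simps)
  then have a: "a = a'"
    using *(4) w_nz \<mu> u(3) \<kappa> by auto
  have hh: "h = h'"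
    using * j a by (simp add: hd hd' P_def P'_def)
  have \<mu>1: "\<mu> \<in> sub q 1"
    using \<mu>q unfolding sub1_eq .
  have "\<beta> * block_map q w g h u2 = \<mu> * block_map q w g h u2"
    using eq(2) block_map_scale[OF \<mu>1, of w g h u2] by (simp add: hh v2')
  then have "\<beta> = \<mu>"
    using block_map_eq_0[OF h u(2)] u(3) by auto
  with hh \<mu>1 show ?thesis
    by simp
qed

end

subsection \<open>Nesting\<close>

lemma odot_iff: "V \<in> odot q M F C \<longleftrightarrow>
    (\<exists>\<Phi>\<in>F. \<exists>U\<in>C. \<exists>\<beta>\<in>sub q M - {0}. V = (\<lambda>x. \<beta> * x) ` \<Phi> ` U)"
  unfolding odot_def orb_def by blast

text \<open>The scalar built into \<open>comp_fam\<close> is exactly the orbit scalar of the inner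
  nesting.\<close>

lemma odot_comp_fam:
  fixes C :: "'a::{field,finite} set set"
  shows "odot q M (comp_fam q m F2 F1) C = odot q M F2 (odot q m F1 C)"
proof -
  have "V \<in> odot q M (comp_fam q m F2 F1) C \<longleftrightarrow> (\<exists>\<Phi>2\<in>F2. \<exists>\<Phi>1\<in>F1. \<exists>\<beta>\<in>sub q m - {0}.
      \<exists>U\<in>C. \<exists>\<gamma>\<in>sub q M - {0}. V = (\<lambda>x. \<gamma> * x) ` (\<lambda>u. \<Phi>2 (\<beta> * \<Phi>1 u)) ` U)" for V
    unfolding odot_iff comp_fam_def by blast
  moreover have "V \<in> odot q M F2 (odot q m F1 C) \<longleftrightarrow> (\<exists>\<Phi>2\<in>F2. \<exists>\<Phi>1\<in>F1. \<exists>\<beta>\<in>sub q m - {0}.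
      \<exists>U\<in>C. \<exists>\<gamma>\<in>sub q M - {0}. V = (\<lambda>x. \<gamma> * x) ` \<Phi>2 ` (\<lambda>x. \<beta> * x) ` \<Phi>1 ` U)" for V
    unfolding odot_iff[of V] odot_iff[of _ q m] Bex_def by blast
  ultimately show ?thesis
    unfolding set_eq_iff by (simp add: image_image)
qed

lemma block_code_eq_odot: "block_code q p m w g = odot q (p * m) (block_fam q p m w g) {sub q m}"
  unfolding block_code_def odot_def by blast

context field_of_order
begin

text \<open>Dependence over \<open>F_q\<close> is phrased by the quotient \<open>x / y\<close>, the
  form in which separation is proved; the second clause is the bound on intersections of distinct
  codewords.\<close>

definition line_meeting :: "nat \<Rightarrow> nat \<Rightarrow> 'a set set \<Rightarrow> bool" where
  "line_meeting k m C \<longleftrightarrow>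
     (\<forall>U\<in>C. U \<subseteq> sub q m \<and> fq_subspace q U \<and> card U = q ^ k) \<and>
     (\<forall>U\<in>C. \<forall>V\<in>C. \<forall>x\<in>U \<inter> V. \<forall>y\<in>U \<inter> V. y \<noteq> 0 \<longrightarrow> x / y \<notin> sub q 1 \<longrightarrow> U = V)"

text \<open>The condition on stabilisers makes orbits as long as possible; it later supplies two
  distinct codewords with a common line.\<close>

definition full_cyclic :: "nat \<Rightarrow> 'a set set \<Rightarrow> bool" where
  "full_cyclic m C \<longleftrightarrow>
     (\<forall>V\<in>C. \<forall>\<beta>\<in>sub q m - {0}. (\<lambda>x. \<beta> * x) ` V \<in> C \<and> ((\<lambda>x. \<beta> * x) ` V = V \<longrightarrow> \<beta> \<in> sub q 1))"

lemma card_sub_1: "card (sub q 1 :: 'a set) = q"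
  using card_sub[of 1] by simp

lemma ex_independent:
  assumes "card (U :: 'a set) = q ^ k" "2 \<le> k"
  obtains x y where "x \<in> U" "y \<in> U" "y \<noteq> 0" "x / y \<notin> sub q 1"
proof -
  have "q ^ 1 < q ^ k"
    using assms q_ge2 by (intro power_strict_increasing) auto
  then have big: "q < card U"
    using assms(1) by simp
  have "\<not> U \<subseteq> {0}"
    using big q_ge2 card_mono[of "{0}" U] by auto
  then obtain y where y: "y \<in> U" "y \<noteq> 0"
    by auto
  have "\<not> U \<subseteq> (\<lambda>c. c * y) ` sub q 1"
  proof
    assume "U \<subseteq> (\<lambda>c. c * y) ` sub q 1"
    then have "card U \<le> card ((\<lambda>c. c * y) ` sub q 1)"
      by (intro card_mono) auto
    also have "\<dots> \<le> q"
      using card_image_le[of "sub q 1 :: 'a set" "\<lambda>c. c * y"] card_sub_1 by simp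
    finally show False
      using big by simp
  qed
  then obtain x where "x \<in> U" "x \<notin> (\<lambda>c. c * y) ` sub q 1"
    by blast
  moreover from this have "x / y \<notin> sub q 1"
    using y(2) by (metis image_eqI nonzero_eq_divide_eq)
  ultimately show thesis
    using that y by blast
qed

lemma line_meeting_sub:
  assumes "m dvd n" "0 < m"
  shows "line_meeting m m {sub q m}"
proof -
  have "sub q 1 \<subseteq> (sub q m :: 'a set)"
    by (rule sub_mono) simp
  then have "fq_subspace q (sub q m :: 'a set)"
    unfolding fq_subspace_def by (auto intro: sub_add sub_mult)
  then show ?thesis
    using card_sub[OF assms] by (simp add: line_meeting_def)
qed

end

section \<open>Codewords of a nested code and their intersections\<close>

context block
begin

text \<open>Recording a codeword by its data makes the nested code the image of a product set, so it
  can be counted through fibres.\<close>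

definition word :: "'a block_index \<times> 'a set \<times> 'a \<Rightarrow> 'a set" where
  "word = (\<lambda>(h, U, \<beta>). (\<lambda>x. \<beta> * x) ` block_map q w g h ` U)"

lemma odot_eq_words:
  "odot q (p * m) (block_fam q p m w g) C = word ` (block_indices q p m \<times> C \<times> (sub q (p * m) - {0}))"
  unfolding set_eq_iff odot_iff block_fam_eq image_iff[of _ word] split_paired_Bex_Sigma
  by (simp add: word_def)

lemma odotE:
  assumes "V \<in> odot q (p * m) (block_fam q p m w g) C"
  obtains h U \<beta> where "V = word (h, U, \<beta>)" "h \<in> block_indices q p m" "U \<in> C"
    "\<beta> \<in> sub q (p * m)" "\<beta> \<noteq> 0"
proof -
  obtain t where t: "t \<in> block_indices q p m \<times> C \<times> (sub q (p * m) - {0})" "V = word t"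
    using assms unfolding odot_eq_words by blast
  obtain h U \<beta> where "t = (h, U, \<beta>)"
    by (cases t) auto
  with t show thesis
    using that by simp
qed

lemma sub_1_subset: "sub q 1 \<subseteq> (sub q m :: 'a set)"
  by (rule sub_mono) simp

text \<open>Two independent common vectors pull back to independent \<open>u1\<close>,
  \<open>u2\<close> in \<open>U\<close> and to \<open>v1\<close>, \<open>v2\<close> in
  \<open>U'\<close>. Separation fixes the index and the ratio of scalars; the invariant for
  \<open>C\<close> then fixes the codeword.\<close>

lemma word_meet:
  assumes C: "line_meeting k m C"
    and h: "h \<in> block_indices q p m" "h' \<in> block_indices q p m"
    and U: "U \<in> C" "U' \<in> C" and \<beta>: "\<beta> \<noteq> 0" "\<beta>' \<noteq> 0"
    and x: "x \<in> word (h, U, \<beta>)" "x \<in> word (h', U', \<beta>')"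
    and y: "y \<in> word (h, U, \<beta>)" "y \<in> word (h', U', \<beta>')" "y \<noteq> 0"
    and indep: "x / y \<notin> sub q 1"
  shows "h = h' \<and> U = U' \<and> \<beta> / \<beta>' \<in> sub q 1"
proof -
  obtain u1 u2 v1 v2 where uv: "u1 \<in> U" "u2 \<in> U" "v1 \<in> U'" "v2 \<in> U'"
    "x = \<beta> * block_map q w g h u1" "x = \<beta>' * block_map q w g h' v1"
    "y = \<beta> * block_map q w g h u2" "y = \<beta>' * block_map q w g h' v2"
    using x y by (auto simp: word_def)
  have sub: "u1 \<in> sub q m" "u2 \<in> sub q m" "v1 \<in> sub q m" "v2 \<in> sub q m"
    using C U uv unfolding line_meeting_def by blast+
  have u2: "u2 \<noteq> 0"
    using uv(7) y(3) by auto
  have u12: "u1 / u2 \<notin> sub q 1"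
  proof
    assume c: "u1 / u2 \<in> sub q 1"
    have "block_map q w g h (u1 / u2 * u2) = u1 / u2 * block_map q w g h u2"
      by (rule block_map_scale[OF c])
    then have "x = u1 / u2 * y"
      using u2 uv(5,7) by simp
    then have "x / y = u1 / u2"
      using y(3) by simp
    with c indep show False
      by simp
  qed
  define c where "c = \<beta> / \<beta>'"
  have c0: "c \<noteq> 0"
    using \<beta> by (simp add: c_def)
  have eq: "c * block_map q w g h u1 = block_map q w g h' v1"
    "c * block_map q w g h u2 = block_map q w g h' v2"
    using uv \<beta> by (simp_all add: c_def field_simps)
  from block_map_separates[OF h sub(1,2) u2 u12 sub(3,4) c0 eq]
  have hc: "h = h'" "c \<in> sub q 1"
    by auto
  \<comment> \<open>The scalar \<open>c\<close> of \<open>F_q\<close> moves inside the map, and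
    injectivity applies; hence \<open>U\<close> and \<open>U'\<close> share the independent vectors
    \<open>v1\<close> and \<open>v2\<close>.\<close>
  have v: "v1 = c * u1" "v2 = c * u2"
    using eq inj_onD[OF inj_on_block_map[OF h(1)]] sub hc sub_1_subset
    by (metis block_map_scale sub_mult subsetD)+
  have "v1 \<in> U" "v2 \<in> U"
    using C U(1) uv hc(2) unfolding v line_meeting_def fq_subspace_def by blast+
  moreover have "v1 / v2 \<notin> sub q 1" "v2 \<noteq> 0"
    using u12 c0 u2 by (simp_all add: v)
  ultimately have "U = U'"
    using C U uv(3,4) unfolding line_meeting_def by blast
  with hc show ?thesis
    by (simp add: c_def)
qed

text \<open>A scalar from \<open>F_q\<close> moves through the linear map and is absorbed by the
  subspace \<open>U\<close>.\<close>

lemma word_scale_subset: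
  assumes "fq_subspace q U" "\<beta> / \<beta>' \<in> sub q 1" "\<beta>' \<noteq> 0"
  shows "word (h, U, \<beta>) \<subseteq> word (h, U, \<beta>')"
proof
  fix x
  assume "x \<in> word (h, U, \<beta>)"
  then obtain u where u: "u \<in> U" "x = \<beta> * block_map q w g h u"
    by (auto simp: word_def)
  have "\<beta> / \<beta>' * u \<in> U"
    using assms(1,2) u(1) unfolding fq_subspace_def by blast
  moreover have "x = \<beta>' * block_map q w g h (\<beta> / \<beta>' * u)"
    unfolding block_map_scale[OF assms(2)] using u assms(3) by simp
  ultimately show "x \<in> word (h, U, \<beta>')"
    by (auto simp: word_def)
qed

lemma word_scale:
  assumes "fq_subspace q U" "\<beta> / \<beta>' \<in> sub q 1" "\<beta> \<noteq> 0" "\<beta>' \<noteq> 0"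
  shows "word (h, U, \<beta>) = word (h, U, \<beta>')"
proof -
  have "\<beta>' / \<beta> \<in> sub q 1"
    using sub_inverse[OF assms(2)] by simp
  then show ?thesis
    using assms word_scale_subset by blast
qed

lemma card_word:
  assumes "h \<in> block_indices q p m" "U \<subseteq> sub q m" "\<beta> \<noteq> 0"
  shows "card (word (h, U, \<beta>)) = card U"
proof -
  have "inj_on (block_map q w g h) U"
    using inj_on_block_map[OF assms(1)] assms(2) inj_on_subset by blast
  moreover have "inj_on (\<lambda>x. \<beta> * x) A" for A :: "'a set"
    using assms(3) by (auto simp: inj_on_def)
  ultimately show ?thesis
    by (simp add: word_def card_image)
qed

lemma fq_subspace_word:
  assumes "fq_subspace q U"
  shows "fq_subspace q (word (h, U, \<beta>))"
  unfolding fq_subspace_def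
proof (intro conjI ballI)
  show "0 \<in> word (h, U, \<beta>)"
    using assms by (auto simp: word_def fq_subspace_def intro!: image_eqI[of _ _ "0::'a"])
next
  fix x y
  assume "x \<in> word (h, U, \<beta>)" "y \<in> word (h, U, \<beta>)"
  then obtain u v where "u \<in> U" "v \<in> U"
    "x = \<beta> * block_map q w g h u" "y = \<beta> * block_map q w g h v"
    by (auto simp: word_def)
  then have "u + v \<in> U" "x + y = \<beta> * block_map q w g h (u + v)"
    using assms by (simp_all add: fq_subspace_def block_map_add algebra_simps)
  then show "x + y \<in> word (h, U, \<beta>)"
    by (auto simp: word_def)
next
  fix c x :: 'a
  assume c: "c \<in> sub q 1" and "x \<in> word (h, U, \<beta>)"
  then obtain u where "u \<in> U" "x = \<beta> * block_map q w g h u"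
    by (auto simp: word_def)
  then have "c * u \<in> U" "c * x = \<beta> * block_map q w g h (c * u)"
    using assms c unfolding fq_subspace_def block_map_scale[OF c] by (blast, simp add: mult.left_commute)
  then show "c * x \<in> word (h, U, \<beta>)"
    by (auto simp: word_def)
qed

lemma word_subset:
  assumes "h \<in> block_indices q p m" "U \<subseteq> sub q m" "\<beta> \<in> sub q (p * m)"
  shows "word (h, U, \<beta>) \<subseteq> sub q (p * m)"
proof
  fix x
  assume "x \<in> word (h, U, \<beta>)"
  then obtain u where "u \<in> U" "x = \<beta> * block_map q w g h u"
    by (auto simp: word_def)
  then show "x \<in> sub q (p * m)"
    using assms block_map_in[OF assms(1), of u] sub_mult by blast
qed

lemma line_meeting_odot:
  assumes C: "line_meeting k m C"
  shows "line_meeting k (p * m) (odot q (p * m) (block_fam q p m w g) C)"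
  unfolding line_meeting_def
proof (intro conjI ballI impI)
  fix V
  assume "V \<in> odot q (p * m) (block_fam q p m w g) C"
  then obtain h U \<beta> where *: "V = word (h, U, \<beta>)" "h \<in> block_indices q p m" "U \<in> C"
    "\<beta> \<in> sub q (p * m)" "\<beta> \<noteq> 0"
    by (rule odotE)
  then have U: "U \<subseteq> sub q m" "fq_subspace q U" "card U = q ^ k"
    using C by (auto simp: line_meeting_def)
  show "V \<subseteq> sub q (p * m)" "fq_subspace q V" "card V = q ^ k"
    using * U by (simp_all add: word_subset fq_subspace_word card_word)
next
  fix V V' x y
  assume "V \<in> odot q (p * m) (block_fam q p m w g) C" "V' \<in> odot q (p * m) (block_fam q p m w g) C"
  then obtain h U \<beta> h' U' \<beta>' where *:
    "V = word (h, U, \<beta>)" "h \<in> block_indices q p m" "U \<in> C" "\<beta> \<noteq> 0"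
    "V' = word (h', U', \<beta>')" "h' \<in> block_indices q p m" "U' \<in> C" "\<beta>' \<noteq> 0"
    by (elim odotE)
  assume "x \<in> V \<inter> V'" "y \<in> V \<inter> V'" "y \<noteq> 0" "x / y \<notin> sub q 1"
  with * have "h = h' \<and> U = U' \<and> \<beta> / \<beta>' \<in> sub q 1"
    using word_meet[OF C, of h h' U U' \<beta> \<beta>' x y] by auto
  then show "V = V'"
    using * C word_scale[of U \<beta> \<beta>' h] by (auto simp: line_meeting_def)
qed

text \<open>If \<open>\<gamma>\<close> fixes a codeword, \<open>word_meet\<close> applied to its two
  scalars \<open>\<gamma> * \<beta>\<close> and \<open>\<beta>\<close> forces
  \<open>\<gamma>\<close> into \<open>F_q\<close>.\<close>

lemma full_cyclic_odot:
  assumes C: "line_meeting k m C" and k: "2 \<le> k"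
  shows "full_cyclic (p * m) (odot q (p * m) (block_fam q p m w g) C)"
  unfolding full_cyclic_def
proof (intro ballI conjI impI)
  fix V and \<gamma> :: 'a
  assume "V \<in> odot q (p * m) (block_fam q p m w g) C"
  then obtain h U \<beta> where V: "V = word (h, U, \<beta>)" "h \<in> block_indices q p m" "U \<in> C"
    "\<beta> \<in> sub q (p * m)" "\<beta> \<noteq> 0"
    by (rule odotE)
  assume \<gamma>: "\<gamma> \<in> sub q (p * m) - {0}"
  have eq: "(\<lambda>x. \<gamma> * x) ` V = word (h, U, \<gamma> * \<beta>)"
    by (simp add: V(1) word_def image_image mult.assoc)
  show "(\<lambda>x. \<gamma> * x) ` V \<in> odot q (p * m) (block_fam q p m w g) C"
    unfolding eq odot_eq_words using V \<gamma> by (intro imageI) (auto intro: sub_mult)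
  assume "(\<lambda>x. \<gamma> * x) ` V = V"
  then have eq': "word (h, U, \<gamma> * \<beta>) = word (h, U, \<beta>)"
    unfolding eq by (simp add: V(1))
  have "card (word (h, U, \<beta>)) = q ^ k"
    using C V by (simp add: card_word line_meeting_def)
  then obtain x y where "x \<in> word (h, U, \<beta>)" "y \<in> word (h, U, \<beta>)" "y \<noteq> 0" "x / y \<notin> sub q 1"
    using ex_independent[OF _ k] by blast
  then have "\<gamma> * \<beta> / \<beta> \<in> sub q 1"
    using word_meet[OF C V(2,2) V(3,3), of "\<gamma> * \<beta>" \<beta> x y] V \<gamma> eq' by auto
  then show "\<gamma> \<in> sub q 1"
    using V(5) by simp
qed

section \<open>Counting a nested code\<close>

lemma block_indices_Sigma: "block_indices q p m =
    (SIGMA l:{..(p - 3) div 2}. polys_below (sub q m :: 'a set) l \<times> (sub q m :: 'a set) \<times> {..q - 2})"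
  by (auto simp: block_indices_def)

lemma card_block_indices:
  "card (block_indices q p m :: 'a block_index set)
     = (\<Sum>l\<le>(p - 3) div 2. (q ^ m) ^ l) * (q ^ m * (q - 1))"
proof -
  have "Suc (q - 2) = q - 1"
    using q_ge2 by simp
  then show ?thesis
    using card_sub[OF m_dvd m(1)]
    by (simp add: block_indices_Sigma card_SigmaI card_polys_below card_cartesian_product sum_distrib_right)
qed

lemma finite_block_indices: "finite (block_indices q p m :: 'a block_index set)"
  unfolding block_indices_Sigma by (intro finite_SigmaI) (auto simp: card_polys_below)

text \<open>Each codeword arises from exactly \<open>q - 1\<close> triples, which differ by nonzero
  scalars of \<open>F_q\<close>. The index \<open>j\<close> also has \<open>q - 1\<close> choices,
  so these factors cancel.\<close>

lemma card_odot:
  assumes C: "line_meeting k m C" and k: "2 \<le> k"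
  shows "real (card (odot q (p * m) (block_fam q p m w g) C)) = real (card C) *
    (real q ^ m * (real q ^ (((p - 3) div 2 + 1) * m) - 1) * (real q ^ (p * m) - 1)
      / (real q ^ m - 1))"
proof -
  define D :: "'a set" where "D = sub q (p * m) - {0}"
  let ?H = "block_indices q p m :: 'a block_index set"
  let ?A = "?H \<times> C \<times> D"
  have fib: "card {t \<in> ?A. word t = V} = q - 1" if "V \<in> word ` ?A" for V
  proof -
    obtain h U \<beta> where V: "V = word (h, U, \<beta>)" "h \<in> ?H" "U \<in> C" "\<beta> \<in> D"
      using \<open>V \<in> word ` ?A\<close> by auto
    then have \<beta>0: "\<beta> \<noteq> 0"
      by (simp add: D_def)
    have U: "fq_subspace q U" "U \<subseteq> sub q m" "card U = q ^ k"
      using C V by (auto simp: line_meeting_def)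
    have "card V = q ^ k"
      using U V \<beta>0 by (simp add: card_word)
    then obtain x y where xy: "x \<in> V" "y \<in> V" "y \<noteq> 0" "x / y \<notin> sub q 1"
      using ex_independent[OF _ k] by blast
    have "{t \<in> ?A. word t = V} = (\<lambda>c. (h, U, c * \<beta>)) ` (sub q 1 - {0})"
    proof (intro equalityI subsetI)
      fix t
      assume "t \<in> {t \<in> ?A. word t = V}"
      then obtain h' U' \<beta>' where t: "t = (h', U', \<beta>')" "h' \<in> ?H" "U' \<in> C" "\<beta>' \<in> D"
        "word (h', U', \<beta>') = V"
        by auto
      then have \<beta>'0: "\<beta>' \<noteq> 0"
        by (simp add: D_def)
      have "h' = h \<and> U' = U \<and> \<beta>' / \<beta> \<in> sub q 1"
        using word_meet[OF C t(2) V(2) t(3) V(3) \<beta>'0 \<beta>0, of x y] xy t V by simp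
      then show "t \<in> (\<lambda>c. (h, U, c * \<beta>)) ` (sub q 1 - {0})"
        using t \<beta>0 \<beta>'0 by (intro image_eqI[of _ _ "\<beta>' / \<beta>"]) auto
    next
      fix t
      assume "t \<in> (\<lambda>c. (h, U, c * \<beta>)) ` (sub q 1 - {0})"
      then obtain c where c: "t = (h, U, c * \<beta>)" "c \<in> sub q 1" "c \<noteq> 0"
        by auto
      have "c \<in> sub q (p * m)"
        using c(2) sub_mono[of 1 "p * m"] by auto
      then have "c * \<beta> \<in> D"
        using V(4) c by (auto simp: D_def intro: sub_mult)
      moreover have "word (h, U, c * \<beta>) = V"
        unfolding V(1) using word_scale[OF U(1), of "c * \<beta>" \<beta>] c(2,3) \<beta>0 by simp
      ultimately show "t \<in> {t \<in> ?A. word t = V}"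
        using c V by simp
    qed
    also have "card \<dots> = card (sub q 1 - {0::'a})"
      using \<beta>0 by (intro card_image) (auto simp: inj_on_def)
    also have "\<dots> = q - 1"
      using card_sub_1 by (simp add: card_Diff_singleton)
    finally show ?thesis .
  qed
  have "card ?A = (q - 1) * card (word ` ?A)"
    by (intro card_eq_fibres fib finite_cartesian_product finite_block_indices) auto
  moreover have "card D = q ^ (p * m) - 1"
    using card_sub[OF m(2)] m(1) p by (simp add: D_def)
  moreover have "word ` ?A = odot q (p * m) (block_fam q p m w g) C"
    by (simp add: odot_eq_words D_def)
  ultimately have "(\<Sum>l\<le>(p - 3) div 2. (q ^ m) ^ l) * (q ^ m * (q - 1)) * (card C * (q ^ (p * m) - 1))
      = (q - 1) * card (odot q (p * m) (block_fam q p m w g) C)"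
    by (simp add: card_cartesian_product card_block_indices)
  then have "(q - 1) * ((\<Sum>l\<le>(p - 3) div 2. (q ^ m) ^ l) * q ^ m * (card C * (q ^ (p * m) - 1)))
      = (q - 1) * card (odot q (p * m) (block_fam q p m w g) C)"
    by (simp only: mult_ac)
  then have nat_eq: "(\<Sum>l\<le>(p - 3) div 2. (q ^ m) ^ l) * q ^ m * (card C * (q ^ (p * m) - 1))
      = card (odot q (p * m) (block_fam q p m w g) C)"
    using q_ge2 by simp
  have Q: "real q ^ m \<noteq> 1"
    using power_gt1[OF m(1)] by (metis less_irrefl of_nat_1_eq_iff of_nat_power)
  \<comment> \<open>There are \<open>(q ^ m) ^ l\<close> polynomials \<open>f\<close> for given
    \<open>l\<close>; their geometric sum is the source of the quotient in the formula.\<close>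
  have "(\<Sum>l\<le>(p - 3) div 2. (real q ^ m) ^ l)
      = (real q ^ (((p - 3) div 2 + 1) * m) - 1) / (real q ^ m - 1)"
    using Q geometric_sum[of "real q ^ m" "Suc ((p - 3) div 2)"]
    by (simp add: lessThan_Suc_atMost mult.commute power_add flip: power_mult)
  moreover have "real (q ^ (p * m) - 1) = real q ^ (p * m) - 1"
    using q_ge2 by (simp add: of_nat_diff)
  ultimately show ?thesis
    unfolding nat_eq[symmetric] by (simp add: of_nat_mult mult_ac)
qed

end

subsection \<open>Distance and iteration\<close>

lemma Nlev_1: "Nlev p e k (Suc 0) = k"
  by (simp add: Nlev_def)

lemma Nlev_Suc: "Nlev p e k (Suc (Suc j)) = p (Suc j) ^ e (Suc j) * Nlev p e k (Suc j)"
proof -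
  have "{1..<Suc (Suc j)} = insert (Suc j) {1..<Suc j}"
    by auto
  then show ?thesis
    by (simp add: Nlev_def mult.assoc)
qed

context field_of_order
begin

lemma sdim_eq: "card V = q ^ d \<Longrightarrow> sdim q V = d"
  unfolding sdim_def using q_ge2 by (intro the_equality) auto

lemma fq_subspace_uminus: "fq_subspace q (V :: 'a set) \<Longrightarrow> v \<in> V \<Longrightarrow> - v \<in> V"
  using sub_uminus[OF sub_1, of 1] by (fastforce simp: fq_subspace_def)

lemma fq_subspace_diff: "fq_subspace q (V :: 'a set) \<Longrightarrow> u \<in> V \<Longrightarrow> v \<in> V \<Longrightarrow> u - v \<in> V"
  using fq_subspace_uminus[of V v] unfolding fq_subspace_def by (metis diff_conv_add_uminus)

text \<open>The dimension formula in counting form: each fibre of addition is a translate of an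
  antidiagonal copy of \<open>U \<inter> V\<close>.\<close>

lemma card_ssum:
  assumes U: "fq_subspace q (U :: 'a set)" and V: "fq_subspace q V"
  shows "card U * card V = card (U \<inter> V) * card (ssum U V)"
proof -
  let ?f = "\<lambda>(u, v). u + v"
  have im: "?f ` (U \<times> V) = ssum U V"
    by (auto simp: ssum_def)
  have "card (U \<times> V) = card (U \<inter> V) * card (?f ` (U \<times> V))"
  proof (rule card_eq_fibres)
    fix s
    assume "s \<in> ?f ` (U \<times> V)"
    then obtain u v where s: "s = u + v" "u \<in> U" "v \<in> V"
      by auto
    have "bij_betw (\<lambda>t. (u + t, v - t)) (U \<inter> V) {x \<in> U \<times> V. ?f x = s}"
    proof (intro bij_betwI')
      fix t
      assume t: "t \<in> U \<inter> V"
      then have "u + t \<in> U" "v - t \<in> V"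
        using s U fq_subspace_diff[OF V] unfolding fq_subspace_def by blast+
      then show "(u + t, v - t) \<in> {x \<in> U \<times> V. ?f x = s}"
        by (simp add: s)
    next
      fix x
      assume "x \<in> {x \<in> U \<times> V. ?f x = s}"
      then obtain u' v' where x: "x = (u', v')" "u' \<in> U" "v' \<in> V" "u' + v' = u + v"
        by (auto simp: s)
      have eq: "u' - u = v - v'"
        using x(4) by (simp add: algebra_simps)
      have "u' - u \<in> U" "v - v' \<in> V"
        using x s fq_subspace_diff[OF U] fq_subspace_diff[OF V] by blast+
      then have "u' - u \<in> U \<inter> V"
        by (simp add: eq)
      moreover have "x = (u + (u' - u), v - (u' - u))"
        by (simp add: x(1)) (simp add: eq)
      ultimately show "\<exists>t\<in>U \<inter> V. x = (u + t, v - t)"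
        by blast
    qed auto
    then show "card {x \<in> U \<times> V. ?f x = s} = card (U \<inter> V)"
      by (simp add: bij_betw_same_card)
  qed simp
  then show ?thesis
    unfolding im by (simp add: card_cartesian_product)
qed

text \<open>Every vector of a nonzero intersection is a scalar multiple of any chosen nonzero
  \<open>y\<close> in it, so the intersection is a line.\<close>

lemma card_Int_line_meeting:
  assumes C: "line_meeting k m C" and UV: "U \<in> C" "V \<in> C" "U \<noteq> V"
  shows "U \<inter> V = {0} \<or> card (U \<inter> V) = q"
proof (rule disjCI)
  assume "card (U \<inter> V) \<noteq> q"
  have sp: "fq_subspace q U" "fq_subspace q V"
    using C UV by (auto simp: line_meeting_def)
  show "U \<inter> V = {0}"
  proof (rule ccontr)
    assume "U \<inter> V \<noteq> {0}"
    moreover have "0 \<in> U \<inter> V"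
      using sp by (simp add: fq_subspace_def)
    ultimately obtain y where y: "y \<in> U \<inter> V" "y \<noteq> 0"
      by blast
    have "U \<inter> V = (\<lambda>c. c * y) ` sub q 1"
    proof (intro equalityI subsetI)
      fix x
      assume x: "x \<in> U \<inter> V"
      then have "x / y \<in> sub q 1"
        using C UV y unfolding line_meeting_def by blast
      then show "x \<in> (\<lambda>c. c * y) ` sub q 1"
        using y(2) by (intro image_eqI[of _ _ "x / y"]) auto
    next
      fix x
      assume "x \<in> (\<lambda>c. c * y) ` sub q 1"
      then show "x \<in> U \<inter> V"
        using sp y(1) unfolding fq_subspace_def by blast
    qed
    then have "card (U \<inter> V) = q"
      using y(2) card_sub_1 by (simp add: card_image inj_on_def)
    then show False
      using \<open>card (U \<inter> V) \<noteq> q\<close> by contradiction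
  qed
qed

text \<open>The sum has dimension \<open>2 * k\<close> or \<open>2 * k - 1\<close>; in the second
  case the intersection subtracts another 1.\<close>

lemma subspace_dist_line_meeting:
  assumes C: "line_meeting k m C" and k: "2 \<le> k" and UV: "U \<in> C" "V \<in> C" "U \<noteq> V"
  shows "subspace_dist q U V = (if U \<inter> V = {0} then 2 * k else 2 * k - 2)"
proof -
  have sp: "fq_subspace q U" "fq_subspace q V" "card U = q ^ k" "card V = q ^ k"
    using C UV by (auto simp: line_meeting_def)
  have prod: "q ^ (2 * k) = card (U \<inter> V) * card (ssum U V)"
    using card_ssum[OF sp(1,2)] sp(3,4) by (simp add: mult_2 power_add)
  show ?thesis
  proof (cases "U \<inter> V = {0}")
    case True
    then show ?thesis
      using prod sdim_eq[of "ssum U V" "2 * k"] sdim_eq[of "{0::'a}" 0]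
      by (simp add: subspace_dist_def)
  next
    case False
    then have I: "card (U \<inter> V) = q"
      using card_Int_line_meeting[OF C UV] by blast
    have "2 * k = Suc (2 * k - 1)"
      using k by simp
    then have "q ^ (2 * k) = q * q ^ (2 * k - 1)"
      by (metis power_Suc)
    with prod I have "card (ssum U V) = q ^ (2 * k - 1)"
      using q_ge2 by simp
    then show ?thesis
      using False I sdim_eq[of "ssum U V" "2 * k - 1"] sdim_eq[of "U \<inter> V" 1]
      by (simp add: subspace_dist_def)
  qed
qed

lemma min_dist_line_meeting:
  assumes C: "line_meeting k m C" and cyc: "full_cyclic m C" and k: "2 \<le> k" and ne: "C \<noteq> {}"
  shows "min_dist q C = 2 * k - 2"
proof -
  let ?D = "{subspace_dist q U V | U V. U \<in> C \<and> V \<in> C \<and> U \<noteq> V}"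
  obtain V where V: "V \<in> C"
    using ne by blast
  have sp: "V \<subseteq> sub q m" "card V = q ^ k"
    using C V by (auto simp: line_meeting_def)
  obtain x y where xy: "x \<in> V" "y \<in> V" "y \<noteq> 0" "x / y \<notin> sub q 1"
    using ex_independent[OF sp(2) k] .
  have x0: "x \<noteq> 0"
    using xy(4) by auto
  \<comment> \<open>Scaling by \<open>x / y\<close> carries \<open>y\<close> to \<open>x\<close>, so
    \<open>x\<close> lies in both subspaces, while the stabiliser condition keeps \<open>W\<close>
    different from \<open>V\<close>.\<close>
  define W where "W = (\<lambda>v. x / y * v) ` V"
  have "x / y \<in> sub q m - {0}"
    using sp(1) xy x0 by (auto intro: sub_divide)
  with cyc V xy(4) have W: "W \<in> C" "V \<noteq> W"
    unfolding full_cyclic_def W_def by metis+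
  have "x \<in> V \<inter> W"
    using xy by (auto simp: W_def intro!: image_eqI[of _ _ y])
  with x0 have "V \<inter> W \<noteq> {0}"
    by blast
  then have "subspace_dist q V W = 2 * k - 2"
    using subspace_dist_line_meeting[OF C k V W] by simp
  then have "2 * k - 2 \<in> ?D"
    using V W by (smt (verit) mem_Collect_eq)
  moreover have "finite ?D"
  proof (rule finite_subset)
    show "?D \<subseteq> (\<lambda>(U, V). subspace_dist q U V) ` (C \<times> C)"
      by auto
  qed auto
  moreover have "2 * k - 2 \<le> d" if d: "d \<in> ?D" for d
  proof -
    obtain U V where "U \<in> C" "V \<in> C" "U \<noteq> V" "d = subspace_dist q U V"
      using d by blast
    then show ?thesis
      using subspace_dist_line_meeting[OF C k, of U V] by (cases "U \<inter> V = {0}") auto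
  qed
  ultimately show ?thesis
    unfolding min_dist_def by (intro Min_eqI)
qed

section \<open>The cardinality factor of one nesting step, and iteration within one prime\<close>

definition orbit_factor :: "nat \<Rightarrow> nat \<Rightarrow> real" where
  "orbit_factor p m = real q ^ m * (real q ^ (((p - 3) div 2 + 1) * m) - 1) * (real q ^ (p * m) - 1)
      / (real q ^ m - 1)"

text \<open>Positivity shows that the final code is nonempty, as its minimum distance
  requires.\<close>

lemma orbit_factor_pos:
  assumes "0 < p" "0 < m"
  shows "0 < orbit_factor p m"
proof -
  have "1 < real q ^ d" if "0 < d" for d
    using power_gt1[OF that] by (metis of_nat_1 of_nat_less_iff of_nat_power)
  then show ?thesis
    using assms q_ge2 by (auto simp: orbit_factor_def intro!: divide_pos_pos mult_pos_pos)
qed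

lemma block_odot:
  assumes "odd p" "3 \<le> p" "0 < m" "p * m dvd n"
    and "primitive_elem q m w" "generates q m (p * m) (g::'a)"
    and C: "line_meeting k m C" and k: "2 \<le> k"
  shows "line_meeting k (p * m) (odot q (p * m) (block_fam q p m w g) C)
    \<and> full_cyclic (p * m) (odot q (p * m) (block_fam q p m w g) C)
    \<and> real (card (odot q (p * m) (block_fam q p m w g) C)) = real (card C) * orbit_factor p m"
proof -
  interpret block q n ty p m w g
    using assms by unfold_locales
  show ?thesis
    using line_meeting_odot[OF C] full_cyclic_odot[OF C k] card_odot[OF C k]
    by (simp only: orbit_factor_def)
qed

text \<open>With \<open>C\<close> arbitrary, one induction serves the first prime, where
  \<open>C\<close> is a single subfield, and later primes, where it is the code built so far.
  Indices start at \<open>Suc i\<close> because the family at 0 is empty by convention.\<close>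

lemma pe_fam_odot:
  assumes p: "odd p" "3 \<le> p" and N: "0 < N" "p ^ e * N dvd n"
    and w: "\<forall>i\<in>{1..e}. primitive_elem q (p ^ (i - 1) * N) (w (p ^ (i - 1) * N))"
    and g: "\<forall>i\<in>{1..e}. generates q (p ^ (i - 1) * N) (p ^ i * N) (g (p ^ (i - 1) * N) :: 'a)"
    and C: "line_meeting k N C" and k: "2 \<le> k"
    and i: "Suc i \<le> e"
  shows "line_meeting k (p ^ Suc i * N) (odot q (p ^ Suc i * N) (pe_fam q p N w g (Suc i)) C)
    \<and> full_cyclic (p ^ Suc i * N) (odot q (p ^ Suc i * N) (pe_fam q p N w g (Suc i)) C)
    \<and> real (card (odot q (p ^ Suc i * N) (pe_fam q p N w g (Suc i)) C))
      = real (card C) * (\<Prod>t\<in>{1..Suc i}. orbit_factor p (p ^ (t - 1) * N))"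
  using i
proof (induction i)
  case 0
  have "p * N dvd p ^ e * N"
    using 0 by (intro mult_dvd_mono) (auto simp: dvd_power)
  then have "p * N dvd n"
    using N(2) dvd_trans by blast
  moreover have "primitive_elem q N (w N)" "generates q N (p * N) (g N)"
    using bspec[OF w, of 1] bspec[OF g, of 1] 0 by auto
  ultimately show ?case
    using block_odot[OF p N(1) _ _ _ C k, of "w N" "g N"] by simp
next
  case (Suc i)
  let ?m = "p ^ Suc i * N"
  have pm: "p ^ Suc (Suc i) * N = p * ?m"
    by simp
  have m: "0 < ?m"
    using p N by simp
  have "p ^ Suc (Suc i) * N dvd p ^ e * N"
    using Suc.prems by (intro mult_dvd_mono le_imp_power_dvd) auto
  then have dvd: "p * ?m dvd n"
    using N(2) dvd_trans unfolding pm by blast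
  have wg: "primitive_elem q ?m (w ?m)" "generates q ?m (p * ?m) (g ?m)"
    using bspec[OF w, of "Suc (Suc i)"] bspec[OF g, of "Suc (Suc i)"] Suc.prems unfolding pm by auto
  have IH: "line_meeting k ?m (odot q ?m (pe_fam q p N w g (Suc i)) C)"
    "real (card (odot q ?m (pe_fam q p N w g (Suc i)) C))
      = real (card C) * (\<Prod>t\<in>{1..Suc i}. orbit_factor p (p ^ (t - 1) * N))"
    using Suc by auto
  \<comment> \<open>Splitting off the outermost building block turns the composed family into one
    more nesting step.\<close>
  have eq: "odot q (p * ?m) (pe_fam q p N w g (Suc (Suc i))) C
      = odot q (p * ?m) (block_fam q p ?m (w ?m) (g ?m)) (odot q ?m (pe_fam q p N w g (Suc i)) C)"
    unfolding pe_fam.simps odot_comp_fam ..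
  have "{1..Suc (Suc i)} = insert (Suc (Suc i)) {1..Suc i}"
    by auto
  then have fac: "(\<Prod>t\<in>{1..Suc (Suc i)}. orbit_factor p (p ^ (t - 1) * N))
      = (\<Prod>t\<in>{1..Suc i}. orbit_factor p (p ^ (t - 1) * N)) * orbit_factor p ?m"
    by (simp add: mult.commute)
  show ?case
    using block_odot[OF p m dvd wg IH(1) k] unfolding pm eq fac IH(2) by (simp only: mult.assoc)
qed

text \<open>Both recursions add a block on the outside; this form makes \<open>pe_fam_odot\<close>
  available for the first prime.\<close>

lemma pe_code_eq_odot:
  "pe_code q p N w g (Suc i) = odot q (p ^ Suc i * N) (pe_fam q p N w g (Suc i)) {sub q N :: 'a set}"
proof (induction i)
  case 0
  show ?case
    by (simp add: block_code_eq_odot)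
next
  case (Suc i)
  then show ?case
    unfolding pe_code.simps pe_fam.simps odot_comp_fam by simp
qed

end

section \<open>Iteration over the primes\<close>

theorem theorem3p15:
  fixes q k n z :: nat and p e :: "nat \<Rightarrow> nat"
    and w g :: "nat \<Rightarrow> 'a::{field,finite}"
  assumes q_pp: "\<exists>r s. prime r \<and> 0 < s \<and> q = r ^ s"
    and k2: "2 \<le> k"
    and z1: "1 \<le> z"
    and primes: "\<forall>j\<in>{1..z}. prime (p j) \<and> odd (p j) \<and> 1 \<le> e j"
    and decr: "\<forall>i\<in>{1..z}. \<forall>j\<in>{1..z}. i < j \<longrightarrow> p j < p i"
    and n_def: "n = (\<Prod>j\<in>{1..z}. p j ^ e j) * k"
    and card_field: "card (UNIV :: 'a set) = q ^ n"
    and w_prim: "\<forall>j\<in>{1..z}. \<forall>i\<in>{1..e j}. primitive_elem q (p j ^ (i - 1) * Nlev p e k j) (w (p j ^ (i - 1) * Nlev p e k j))"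
    and g_gen: "\<forall>j\<in>{1..z}. \<forall>i\<in>{1..e j}.
        generates q (p j ^ (i - 1) * Nlev p e k j) (p j ^ i * Nlev p e k j) (g (p j ^ (i - 1) * Nlev p e k j))"
  shows "full_code q p e k w g z \<subseteq> grass q n k
    \<and> (\<forall>V\<in>full_code q p e k w g z. orb q n V \<subseteq> full_code q p e k w g z)
    \<and> real (card (full_code q p e k w g z)) =
        (\<Prod>j\<in>{1..z}. \<Prod>i\<in>{1..e j}.
           (real q ^ (p j ^ (i - 1) * Nlev p e k j)
             * (real q ^ (((p j - 3) div 2 + 1) * (p j ^ (i - 1) * Nlev p e k j)) - 1)
             * (real q ^ (p j ^ i * Nlev p e k j) - 1))
           / (real q ^ (p j ^ (i - 1) * Nlev p e k j) - 1))
    \<and> min_dist q (full_code q p e k w g z) = 2 * k - 2"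
proof -
  have p: "odd (p j)" "3 \<le> p j" "1 \<le> e j" if "j \<in> {1..z}" for j
  proof -
    have pj: "prime (p j)" "odd (p j)" "1 \<le> e j"
      using primes that by auto
    then show "odd (p j)" "1 \<le> e j"
      by auto
    show "3 \<le> p j"
      using pj prime_ge_2_nat[OF pj(1)] by (cases "p j = 2") auto
  qed
  have N_pos: "0 < Nlev p e k (Suc j)" if "j \<le> z" for j
  proof -
    have "0 < p h ^ e h" if "h \<in> {1..<Suc j}" for h
      using p(2)[of h] that \<open>j \<le> z\<close> by auto
    then have "0 < (\<Prod>h\<in>{1..<Suc j}. p h ^ e h)"
      by (intro prod_pos) blast
    then show ?thesis
      using k2 by (simp add: Nlev_def)
  qed
  have n_eq: "n = Nlev p e k (Suc z)"
    by (simp add: n_def Nlev_def atLeastLessThanSuc_atLeastAtMost)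
  have N_dvd: "Nlev p e k (Suc j) dvd n" if "j \<le> z" for j
    unfolding n_eq Nlev_def using that by (intro mult_dvd_mono prod_dvd_prod_subset) auto
  have "0 < n"
    using N_pos[of z] n_eq by simp
  then interpret field_of_order q n "TYPE('a)"
    using q_pp card_field by unfold_locales
  \<comment> \<open>\<open>Nlev\<close> at an index multiplies only earlier prime powers, so the
    level reached after \<open>Suc j\<close> primes has index \<open>Suc (Suc j)\<close>. The code
    at 0 is a default value, so stages start at 1.\<close>
  have main: "line_meeting k (Nlev p e k (Suc (Suc j))) (full_code q p e k w g (Suc j))
      \<and> full_cyclic (Nlev p e k (Suc (Suc j))) (full_code q p e k w g (Suc j))
      \<and> real (card (full_code q p e k w g (Suc j)))
        = (\<Prod>j\<in>{1..Suc j}. \<Prod>i\<in>{1..e j}. orbit_factor (p j) (p j ^ (i - 1) * Nlev p e k j))"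
    if "Suc j \<le> z" for j
    using that
  proof (induction j)
    case 0
    then have z: "1 \<in> {1..z}"
      by simp
    obtain e' where e': "e 1 = Suc e'"
      using p(3)[OF z] by (cases "e 1") auto
    have N: "Nlev p e k (Suc (Suc 0)) = p 1 ^ e 1 * Nlev p e k 1"
      by (simp add: Nlev_Suc)
    have dvd: "p 1 ^ e 1 * Nlev p e k 1 dvd n"
      using N_dvd[of 1] z by (simp add: Nlev_Suc)
    have C: "line_meeting k (Nlev p e k 1) {sub q (Nlev p e k 1) :: 'a set}"
      using line_meeting_sub[of k] N_dvd[of 0] k2 by (simp add: Nlev_1)
    have pe: "pe_code q (p 1) (Nlev p e k 1) w g (e 1)
        = odot q (p 1 ^ e 1 * Nlev p e k 1) (pe_fam q (p 1) (Nlev p e k 1) w g (e 1))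
            {sub q (Nlev p e k 1)}"
      by (simp only: e' pe_code_eq_odot)
    have "0 < Nlev p e k 1"
      using k2 by (simp add: Nlev_1)
    from pe_fam_odot[OF p(1,2)[OF z] this dvd bspec[OF w_prim z] bspec[OF g_gen z] C k2, of e', folded e']
    show ?case
      unfolding full_code.simps N pe by simp
  next
    case (Suc j)
    let ?j = "Suc (Suc j)"
    have z: "?j \<in> {1..z}"
      using Suc.prems by simp
    obtain e' where e': "e ?j = Suc e'"
      using p(3)[OF z] by (cases "e ?j") auto
    have N: "Nlev p e k (Suc ?j) = p ?j ^ e ?j * Nlev p e k ?j"
      by (rule Nlev_Suc)
    have dvd: "p ?j ^ e ?j * Nlev p e k ?j dvd n"
      using N_dvd[of ?j] z unfolding N by simp
    have C: "line_meeting k (Nlev p e k ?j) (full_code q p e k w g (Suc j))"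
      and card: "real (card (full_code q p e k w g (Suc j)))
        = (\<Prod>j\<in>{1..Suc j}. \<Prod>i\<in>{1..e j}. orbit_factor (p j) (p j ^ (i - 1) * Nlev p e k j))"
      using Suc by auto
    have "{1..?j} = insert ?j {1..Suc j}"
      by auto
    then have fac: "(\<Prod>j\<in>{1..?j}. \<Prod>i\<in>{1..e j}. orbit_factor (p j) (p j ^ (i - 1) * Nlev p e k j))
      = (\<Prod>j\<in>{1..Suc j}. \<Prod>i\<in>{1..e j}. orbit_factor (p j) (p j ^ (i - 1) * Nlev p e k j))
        * (\<Prod>i\<in>{1..e ?j}. orbit_factor (p ?j) (p ?j ^ (i - 1) * Nlev p e k ?j))"
      by (simp add: mult.commute)
    have "0 < Nlev p e k ?j"
      using N_pos[of "Suc j"] Suc.prems by simp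
    from pe_fam_odot[OF p(1,2)[OF z] this dvd bspec[OF w_prim z] bspec[OF g_gen z] C k2, of e', folded e']
    show ?case
      unfolding full_code.simps N fac card[symmetric] by simp
  qed
  obtain j where j: "z = Suc j"
    using z1 by (cases z) auto
  let ?C = "full_code q p e k w g z"
  have C: "line_meeting k n ?C" "full_cyclic n ?C"
    and card: "real (card ?C)
      = (\<Prod>j\<in>{1..z}. \<Prod>i\<in>{1..e j}. orbit_factor (p j) (p j ^ (i - 1) * Nlev p e k j))"
    using main[of j] unfolding n_eq j by auto
  have "0 < orbit_factor (p j) (p j ^ (i - 1) * Nlev p e k j)" if "j \<in> {1..z}" for i j
    using p(2)[OF that] N_pos[of "j - 1"] that by (intro orbit_factor_pos) auto
  then have "0 < real (card ?C)"
    unfolding card by (intro prod_pos) blast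
  then have "?C \<noteq> {}"
    by auto
  then have "min_dist q ?C = 2 * k - 2"
    by (rule min_dist_line_meeting[OF C k2])
  moreover have "?C \<subseteq> grass q n k"
    using C(1) sdim_eq by (auto simp: line_meeting_def grass_def)
  moreover have "orb q n V \<subseteq> ?C" if "V \<in> ?C" for V
    using C(2) that by (auto simp: full_cyclic_def orb_def)
  \<comment> \<open>The factors agree up to writing \<open>p j * p j ^ (i - 1)\<close> as
    \<open>p j ^ i\<close>, which holds because \<open>i\<close> is at least 1.\<close>
  moreover have "(\<Prod>i\<in>{1..e j}. orbit_factor (p j) (p j ^ (i - 1) * Nlev p e k j))
      = (\<Prod>i\<in>{1..e j}. (real q ^ (p j ^ (i - 1) * Nlev p e k j)
             * (real q ^ (((p j - 3) div 2 + 1) * (p j ^ (i - 1) * Nlev p e k j)) - 1)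
             * (real q ^ (p j ^ i * Nlev p e k j) - 1))
           / (real q ^ (p j ^ (i - 1) * Nlev p e k j) - 1))" for j
  proof (rule prod.cong)
    fix i
    assume "i \<in> {1..e j}"
    then have "p j * (p j ^ (i - 1) * Nlev p e k j) = p j ^ i * Nlev p e k j"
      by (cases i) auto
    then show "orbit_factor (p j) (p j ^ (i - 1) * Nlev p e k j)
      = (real q ^ (p j ^ (i - 1) * Nlev p e k j)
             * (real q ^ (((p j - 3) div 2 + 1) * (p j ^ (i - 1) * Nlev p e k j)) - 1)
             * (real q ^ (p j ^ i * Nlev p e k j) - 1))
           / (real q ^ (p j ^ (i - 1) * Nlev p e k j) - 1)"
      unfolding orbit_factor_def by (simp only:)
  qed simp
  ultimately show ?thesis
    using card by simp
qed

end
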